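(* Let $\mathscr{C}$ be a polyhedral complex in $\mathbb{R}^r$ and $\Omega\subset|\mathscr{C}|$ a polyhedrally star shaped open subset with centre $z$. Let $\alpha\in A^{p,q}(\Omega)$ with $p>0$ and $d'\alpha=0$. Then there exists $\beta\in A^{p-1,q}(\Omega)$ such that $d'\beta=\alpha$.
   Context: A polyhedron in $\mathbb{R}^r$ is a finite intersection of closed affine half-spaces (no rationality assumption). A polyhedral complex $\mathscr{C}$ in $\mathbb{R}^r$ is a finite set of polyhedra such that every face of a member is a member and the intersection of two members is a face of both (the empty set counts as a face). Its support $|\mathscr{C}|$ is the union of its members, with the subspace topology. A maximal polyhedron is one not properly contained in another member. For a polyhedron $\sigma$, $\mathbb{L}_\sigma\subset\mathbb{R}^r$ is the linear subspace parallel to its affine span. Superforms on open $U\subset\mathbb{R}^r$: $A^{p,q}(U):=A^p(U)\otimes_{\mathbb{R}}\Lambda^q(\mathbb{R}^r)^*$, where $A^p(U)$ is the space of smooth real $p$-forms; $d':=D\otimes\mathrm{id}:A^{p,q}(U)\to A^{p+1,q}(U)$ with $D$ the exterior derivative. $\langle\alpha(x);v_1,\dots,v_p,w_1,\dots,w_q\rangle$ denotes evaluation of the first factor at $x$ on the $v_i$ and of the second factor on the $w_j$. Superforms on open $\Omega\subset|\mathscr{C}|$: an element of $A^{p,q}(\Omega)$ is given by some $\alpha'\in A^{p,q}(V)$ with $V\subset\mathbb{R}^r$ open and $V\cap|\mathscr{C}|=\Omega$; $\alpha'\in A^{p,q}(V)$ and $\alpha''\in A^{p,q}(W)$ define the same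 element iff for all $\sigma\in\mathscr{C}$, $x\in\sigma\cap\Omega$, and $v_i,w_j\in\mathbb{L}_\sigma$ one has $\langle\alpha'(x);v_1,\dots,v_p,w_1,\dots,w_q\rangle=\langle\alpha''(x);v_1,\dots,v_p,w_1,\dots,w_q\rangle$. The operator $d'$ is induced by the one on representatives. $A^{p,q}(\Omega)$ depends only on $\Omega$, not on the complex $\mathscr{C}$ having $\Omega$ as an open subset of its support. An open subset $\Omega\subset|\mathscr{C}|$ is polyhedrally star shaped with centre $z$ if there is a polyhedral complex $\mathscr{D}$ such that $\Omega$ is an open subset of $|\mathscr{D}|$ and for all maximal $\sigma\in\mathscr{D}$, all $x\in\sigma\cap\Omega$ and all $t\in[0,1]$, the point $z+t(x-z)$ lies in $\sigma\cap\Omega$. *)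

theory Defs
  imports "HOL-Analysis.Analysis"
begin

section \<open>Polyhedral complexes\<close>

text \<open>For a polyhedron, the faces in the sense of \<open>face_of\<close> are the intersections with
  supporting hyperplanes, the polyhedron itself and the empty set
  (\<open>exposed_face_of_polyhedron\<close>).\<close>

definition polyhedral_complex :: "'a::euclidean_space set set \<Rightarrow> bool" where
  "polyhedral_complex C \<longleftrightarrow>
     finite C \<and>
     (\<forall>\<sigma>\<in>C. polyhedron \<sigma>) \<and>
     (\<forall>\<sigma>\<in>C. \<forall>\<tau>. \<tau> face_of \<sigma> \<longrightarrow> \<tau> \<in> C) \<and>
     (\<forall>\<sigma>\<in>C. \<forall>\<tau>\<in>C. (\<sigma> \<inter> \<tau>) face_of \<sigma> \<and> (\<sigma> \<inter> \<tau>) face_of \<tau>)"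

definition maximal_in :: "'a set set \<Rightarrow> 'a set \<Rightarrow> bool" where
  "maximal_in C \<sigma> \<longleftrightarrow> \<sigma> \<in> C \<and> (\<forall>\<tau>\<in>C. \<not> \<sigma> \<subset> \<tau>)"

text \<open>The linear subspace parallel to the affine span, for nonempty \<open>\<sigma>\<close>. (It is empty for
  \<open>\<sigma> = {}\<close>, but it is only used together with a point of \<open>\<sigma>\<close>.)\<close>

definition direction_space :: "'a::real_vector set \<Rightarrow> 'a set" where
  "direction_space \<sigma> = {x - y | x y. x \<in> affine hull \<sigma> \<and> y \<in> affine hull \<sigma>}"

definition polyhedrally_star_shaped :: "'a::euclidean_space set \<Rightarrow> 'a \<Rightarrow> bool" where
  "polyhedrally_star_shaped \<Omega> z \<longleftrightarrow>
     (\<exists>D. polyhedral_complex D \<and> openin (top_of_set (\<Union>D)) \<Omega> \<and>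
          (\<forall>\<sigma>. maximal_in D \<sigma> \<longrightarrow>
             (\<forall>x\<in>\<sigma> \<inter> \<Omega>. \<forall>t\<in>{0..1}. z + t *\<^sub>R (x - z) \<in> \<sigma> \<inter> \<Omega>)))"

section \<open>Superforms on open subsets of Euclidean space\<close>

text \<open>The class \<open>C^k\<close> on open sets, and smoothness.\<close>

primrec Ck_on :: "nat \<Rightarrow> 'a::euclidean_space set \<Rightarrow> ('a \<Rightarrow> real) \<Rightarrow> bool" where
  "Ck_on 0 U f \<longleftrightarrow> continuous_on U f"
| "Ck_on (Suc k) U f \<longleftrightarrow>
     (\<forall>x\<in>U. f differentiable (at x)) \<and>
     (\<forall>v. Ck_on k U (\<lambda>x. frechet_derivative f (at x) v))"

definition smooth_on :: "'a::euclidean_space set \<Rightarrow> ('a \<Rightarrow> real) \<Rightarrow> bool" where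
  "smooth_on U f \<longleftrightarrow> (\<forall>k. Ck_on k U f)"

text \<open>An alternating \<open>p\<close>-linear form takes its arguments as a list of length \<open>p\<close>; its values on
  lists of any other length are irrelevant.\<close>

definition alternating_form :: "nat \<Rightarrow> ('a::real_vector list \<Rightarrow> real) \<Rightarrow> bool" where
  "alternating_form p \<eta> \<longleftrightarrow>
     (\<forall>v. length v = p \<longrightarrow>
        (\<forall>i<p. linear (\<lambda>u. \<eta> (v[i := u]))) \<and>
        (\<forall>i<p. \<forall>j<p. i \<noteq> j \<and> v ! i = v ! j \<longrightarrow> \<eta> v = 0))"

definition smooth_form_on ::
    "'a::euclidean_space set \<Rightarrow> nat \<Rightarrow> ('a \<Rightarrow> 'a list \<Rightarrow> real) \<Rightarrow> bool" where
  "smooth_form_on U p \<omega> \<longleftrightarrow>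
     (\<forall>x\<in>U. alternating_form p (\<omega> x)) \<and>
     (\<forall>v. length v = p \<longrightarrow> smooth_on U (\<lambda>x. \<omega> x v))"

text \<open>The invariant formula for the exterior derivative on constant vector fields
  \<open>v\<^sub>0, \<dots>, v\<^sub>p\<close>: the \<open>i\<close>-th summand is \<open>(-1)^i\<close> times the derivative in direction \<open>v\<^sub>i\<close> of \<open>\<omega>\<close>
  evaluated on the remaining fields.\<close>

definition ext_deriv ::
    "('a::euclidean_space \<Rightarrow> 'a list \<Rightarrow> real) \<Rightarrow> 'a \<Rightarrow> 'a list \<Rightarrow> real" where
  "ext_deriv \<omega> x v =
     (\<Sum>i<length v. (- 1) ^ i *
        frechet_derivative (\<lambda>y. \<omega> y (take i v @ drop (Suc i) v)) (at x) (v ! i))"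

text \<open>A superform \<open>\<alpha>\<close> is represented by its evaluation: \<open>\<alpha> x v w\<close> is
  \<open>\<langle>\<alpha>(x); v\<^sub>1, \<dots>, v\<^sub>p, w\<^sub>1, \<dots>, w\<^sub>q\<rangle>\<close>.\<close>

type_synonym 'a superform = "'a \<Rightarrow> 'a list \<Rightarrow> 'a list \<Rightarrow> real"

text \<open>The tensor product of the smooth \<open>p\<close>-forms on \<open>U\<close> with the alternating \<open>q\<close>-forms: finite sums
  of tensors \<open>\<omega> \<otimes> \<eta>\<close>, identified with their evaluation functions. (The map from the algebraic
  tensor product over a field to functions is injective, so nothing is lost.) Values off \<open>U\<close> and on
  lists of the wrong lengths are irrelevant.\<close>

definition superform_on :: "'a::euclidean_space set \<Rightarrow> nat \<Rightarrow> nat \<Rightarrow> 'a superform \<Rightarrow> bool" where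
  "superform_on U p q \<alpha> \<longleftrightarrow>
     (\<exists>m \<omega> \<eta>.
        (\<forall>k<m::nat. smooth_form_on U p (\<omega> k) \<and> alternating_form q (\<eta> k)) \<and>
        (\<forall>x\<in>U. \<forall>v w. length v = p \<and> length w = q \<longrightarrow>
           \<alpha> x v w = (\<Sum>k<m. \<omega> k x v * \<eta> k w)))"

text \<open>The operator \<open>d' = D \<otimes> id\<close>; see \<open>dprime_tensor\<close> below.\<close>

definition dprime :: "'a::euclidean_space superform \<Rightarrow> 'a superform" where
  "dprime \<alpha> x v w = ext_deriv (\<lambda>y u. \<alpha> y u w) x v"

lemma dprime_tensor:
  fixes \<omega> :: "nat \<Rightarrow> 'a::euclidean_space \<Rightarrow> 'a list \<Rightarrow> real"
  assumes "open U" and x: "x \<in> U"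
    and smooth: "\<And>k. k < m \<Longrightarrow> smooth_form_on U p (\<omega> k)"
    and eq: "\<And>y v w. \<lbrakk>y \<in> U; length v = p; length w = q\<rbrakk> \<Longrightarrow>
               \<alpha> y v w = (\<Sum>k<m. \<omega> k y v * \<eta> k w)"
    and v: "length v = Suc p" and w: "length w = q"
  shows "dprime \<alpha> x v w = (\<Sum>k<m. ext_deriv (\<omega> k) x v * \<eta> k w)"
proof -
  have fd: "frechet_derivative (\<lambda>y. \<alpha> y u w) (at x) h =
            (\<Sum>k<m. frechet_derivative (\<lambda>y. \<omega> k y u) (at x) h * \<eta> k w)"
    if u: "length u = p" for u h
  proof -
    have "((\<lambda>y. \<omega> k y u) has_derivative frechet_derivative (\<lambda>y. \<omega> k y u) (at x)) (at x)"
      if "k < m" for k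
    proof -
      have "Ck_on (Suc 0) U (\<lambda>y. \<omega> k y u)"
        using smooth[OF that] u unfolding smooth_form_on_def smooth_on_def by blast
      then show ?thesis
        using x frechet_derivative_works by auto
    qed
    then have "((\<lambda>y. \<Sum>k<m. \<omega> k y u * \<eta> k w) has_derivative
          (\<lambda>h. \<Sum>k<m. frechet_derivative (\<lambda>y. \<omega> k y u) (at x) h * \<eta> k w)) (at x)"
      by (intro has_derivative_sum has_derivative_mult_left) auto
    then have "((\<lambda>y. \<alpha> y u w) has_derivative
          (\<lambda>h. \<Sum>k<m. frechet_derivative (\<lambda>y. \<omega> k y u) (at x) h * \<eta> k w)) (at x)"
      by (rule has_derivative_transform_within_open[OF _ \<open>open U\<close> x]) (simp add: eq u w)
    from frechet_derivative_at[OF this, symmetric] show ?thesis by simp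
  qed
  have "dprime \<alpha> x v w =
        (\<Sum>i<length v. (- 1) ^ i * (\<Sum>k<m.
           frechet_derivative (\<lambda>y. \<omega> k y (take i v @ drop (Suc i) v)) (at x) (v ! i) * \<eta> k w))"
    unfolding dprime_def ext_deriv_def by (intro sum.cong refl arg_cong2[where f = "(*)"] fd) (use v in auto)
  also have "\<dots> = (\<Sum>k<m. ext_deriv (\<omega> k) x v * \<eta> k w)"
    unfolding ext_deriv_def sum_distrib_left sum_distrib_right
    by (subst sum.swap) (simp add: mult.assoc)
  finally show ?thesis .
qed

section \<open>Superforms on open subsets of polyhedral complexes\<close>

text \<open>A representative is a pair of an open \<open>V\<close> with \<open>V \<inter> |C| = \<Omega>\<close> and a superform on \<open>V\<close>; a
  superform on \<open>\<Omega>\<close> is a class of representatives.\<close>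

definition superform_reps ::
    "'a::euclidean_space set set \<Rightarrow> 'a set \<Rightarrow> nat \<Rightarrow> nat \<Rightarrow> ('a set \<times> 'a superform) set" where
  "superform_reps C \<Omega> p q = {(V, \<alpha>). open V \<and> V \<inter> \<Union>C = \<Omega> \<and> superform_on V p q \<alpha>}"

definition superform_rel ::
    "'a::euclidean_space set set \<Rightarrow> 'a set \<Rightarrow> nat \<Rightarrow> nat \<Rightarrow> ('a set \<times> 'a superform) rel" where
  "superform_rel C \<Omega> p q =
     {((V, \<alpha>), (W, \<beta>)).
        (V, \<alpha>) \<in> superform_reps C \<Omega> p q \<and> (W, \<beta>) \<in> superform_reps C \<Omega> p q \<and>
        (\<forall>\<sigma>\<in>C. \<forall>x\<in>\<sigma> \<inter> \<Omega>. \<forall>v w.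
           length v = p \<and> length w = q \<and>
           set v \<subseteq> direction_space \<sigma> \<and> set w \<subseteq> direction_space \<sigma> \<longrightarrow>
           \<alpha> x v w = \<beta> x v w)}"

lemma equiv_superform_rel: "equiv (superform_reps C \<Omega> p q) (superform_rel C \<Omega> p q)"
proof (rule equivI)
  show "superform_rel C \<Omega> p q \<subseteq> superform_reps C \<Omega> p q \<times> superform_reps C \<Omega> p q"
    by (auto simp: superform_rel_def)
  show "refl_on (superform_reps C \<Omega> p q) (superform_rel C \<Omega> p q)"
    by (auto simp: refl_on_def superform_rel_def)
  show "sym (superform_rel C \<Omega> p q)"
    unfolding sym_def superform_rel_def by auto
  show "trans (superform_rel C \<Omega> p q)"
    unfolding trans_def superform_rel_def by clarsimp
qed

definition superforms ::
    "'a::euclidean_space set set \<Rightarrow> 'a set \<Rightarrow> nat \<Rightarrow> nat \<Rightarrow> ('a set \<times> 'a superform) set set" where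
  "superforms C \<Omega> p q = superform_reps C \<Omega> p q // superform_rel C \<Omega> p q"

definition superform_zero ::
    "'a::euclidean_space set set \<Rightarrow> 'a set \<Rightarrow> nat \<Rightarrow> nat \<Rightarrow> ('a set \<times> 'a superform) set" where
  "superform_zero C \<Omega> p q =
     superform_rel C \<Omega> p q `` {(V, \<lambda>x v w. 0) | V. open V \<and> V \<inter> \<Union>C = \<Omega>}"

text \<open>The operator \<open>d'\<close> from bidegree \<open>(p, q)\<close> to \<open>(p + 1, q)\<close> induced on classes: the class of
  \<open>(V, dprime \<alpha>)\<close> for any representative \<open>(V, \<alpha>)\<close>.\<close>

definition superform_dprime ::
    "'a::euclidean_space set set \<Rightarrow> 'a set \<Rightarrow> nat \<Rightarrow> nat \<Rightarrow>
     ('a set \<times> 'a superform) set \<Rightarrow> ('a set \<times> 'a superform) set" where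
  "superform_dprime C \<Omega> p q A =
     superform_rel C \<Omega> (p + 1) q `` ((\<lambda>(V, \<alpha>). (V, dprime \<alpha>)) ` A)"

end

theory Submission
  imports Defs
begin

text \<open>Shrink the domain of a representative of \<open>\<alpha>\<close> to the open set \<open>U\<close> of points \<open>x\<close> whose segment to \<open>z\<close>
  stays inside. On \<open>U\<close> the radial homotopy operator \<open>K\<close> of the Poincare lemma, applied to the first
  tensor factor, satisfies \<open>d' K + K d' = id\<close>. Although \<open>d' \<alpha>\<close> need not vanish on \<open>U\<close>, it vanishes on the
  directions of the polyhedra; for \<open>x\<close> in a maximal \<open>\<sigma>\<close> of the complex \<open>D\<close> witnessing star-shapedness, the
  segment from \<open>z\<close> to \<open>x\<close> stays in \<open>\<sigma>\<close> and \<open>x - z\<close> is a direction of \<open>\<sigma>\<close>, so \<open>K d' \<alpha>\<close> vanishes on the directions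
  of \<open>\<sigma>\<close>. Passing between \<open>C\<close> and \<open>D\<close> is possible since at each point of \<open>\<Omega>\<close> every direction
  space of one complex is contained in one of the other.\<close>

section \<open>Smooth functions and radial integration\<close>

text \<open>At a point of the open set \<open>U\<close>, \<open>frechet_derivative\<close> sees only
  values in \<open>U\<close>. This matters because forms are specified only on their domain.\<close>

lemma Ck_on_cong:
  assumes "open U" "Ck_on k U f" "\<And>x. x \<in> U \<Longrightarrow> f x = g x"
  shows "Ck_on k U g"
  using assms(2,3)
proof (induction k arbitrary: f g)
  case 0
  then show ?case by (simp cong: continuous_on_cong)
next
  case (Suc k)
  have d: "(g has_derivative frechet_derivative f (at x)) (at x)" if "x \<in> U" for x
    using Suc.prems that \<open>open U\<close>
    by (metis Ck_on.simps(2) frechet_derivative_works has_derivative_transform_within_open)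
  then have "frechet_derivative f (at x) = frechet_derivative g (at x)" if "x \<in> U" for x
    using frechet_derivative_at that by blast
  then have "Ck_on k U (\<lambda>x. frechet_derivative g (at x) v)" for v
    using Suc.IH[of "\<lambda>x. frechet_derivative f (at x) v"] Suc.prems(1) by simp
  then show ?case using d by (auto simp: differentiable_def)
qed

text \<open>Derivatives are unique, so an explicit formula may replace the choice operator
  \<open>frechet_derivative\<close>; sums, products and cone integrals are treated this way.\<close>

lemma Ck_on_SucI:
  assumes "open U" "\<And>x. x \<in> U \<Longrightarrow> (f has_derivative f' x) (at x)"
    and "\<And>v. Ck_on k U (\<lambda>x. f' x v)"
  shows "Ck_on (Suc k) U f"
proof -
  have "f' x = frechet_derivative f (at x)" if "x \<in> U" for x
    using assms(2)[OF that] by (rule frechet_derivative_at)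
  then have "Ck_on k U (\<lambda>x. frechet_derivative f (at x) v)" for v
    using Ck_on_cong[OF \<open>open U\<close> assms(3)] by simp
  then show ?thesis using assms(2) by (auto simp: differentiable_def)
qed

lemma Ck_on_Suc_has_derivative:
  "Ck_on (Suc k) U f \<Longrightarrow> x \<in> U \<Longrightarrow> (f has_derivative frechet_derivative f (at x)) (at x)"
  using frechet_derivative_works by auto

lemma Ck_on_SucD: "Ck_on (Suc k) U f \<Longrightarrow> Ck_on k U f"
proof (induction k arbitrary: f)
  case 0
  then show ?case
    by (auto intro!: continuous_at_imp_continuous_on differentiable_imp_continuous_within)
next
  case (Suc k)
  then show ?case by (metis Ck_on.simps(2))
qed

lemma Ck_on_imp_continuous_on: "Ck_on k U f \<Longrightarrow> continuous_on U f"
  by (induction k) (auto dest: Ck_on_SucD simp del: Ck_on.simps(2))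

lemma Ck_on_subset: "Ck_on k U f \<Longrightarrow> V \<subseteq> U \<Longrightarrow> Ck_on k V f"
  by (induction k arbitrary: f) (auto intro: continuous_on_subset)

lemma Ck_on_const: "Ck_on k U (\<lambda>x. c)"
  by (induction k arbitrary: c) auto

lemma Ck_on_add:
  assumes "open U" "Ck_on k U f" "Ck_on k U g"
  shows "Ck_on k U (\<lambda>x. f x + g x)"
  using assms(2,3)
proof (induction k arbitrary: f g)
  case 0
  then show ?case by (auto intro: continuous_intros)
next
  case (Suc k)
  show ?case
  proof (rule Ck_on_SucI[OF \<open>open U\<close>])
    show "((\<lambda>x. f x + g x) has_derivative
        (\<lambda>h. frechet_derivative f (at x) h + frechet_derivative g (at x) h)) (at x)"
      if "x \<in> U" for x
      using Suc.prems[THEN Ck_on_Suc_has_derivative, OF that] by (rule has_derivative_add)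
    show "Ck_on k U (\<lambda>x. frechet_derivative f (at x) v + frechet_derivative g (at x) v)" for v
      using Suc.prems by (intro Suc.IH) auto
  qed
qed

lemma Ck_on_mult:
  assumes "open U" "Ck_on k U f" "Ck_on k U g"
  shows "Ck_on k U (\<lambda>x. f x * g x)"
  using assms(2,3)
proof (induction k arbitrary: f g)
  case 0
  then show ?case by (auto intro: continuous_intros)
next
  case (Suc k)
  show ?case
  proof (rule Ck_on_SucI[OF \<open>open U\<close>])
    show "((\<lambda>x. f x * g x) has_derivative
        (\<lambda>h. f x * frechet_derivative g (at x) h + frechet_derivative f (at x) h * g x)) (at x)"
      if "x \<in> U" for x
      using Suc.prems[THEN Ck_on_Suc_has_derivative, OF that] by (rule has_derivative_mult)
    show "Ck_on k U (\<lambda>x. f x * frechet_derivative g (at x) v + frechet_derivative f (at x) v * g x)" for v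
      \<comment> \<open>The product rule pairs each factor with a derivative of the other, so the
        factors themselves are also needed in class \<open>k\<close>.\<close>
      using Suc.prems Suc.prems[THEN Ck_on_SucD]
      by (intro Ck_on_add[OF \<open>open U\<close>] Suc.IH) auto
  qed
qed

lemma smooth_on_cong:
  "open U \<Longrightarrow> smooth_on U f \<Longrightarrow> (\<And>x. x \<in> U \<Longrightarrow> f x = g x) \<Longrightarrow> smooth_on U g"
  unfolding smooth_on_def by (blast intro: Ck_on_cong)

lemma smooth_on_has_derivative:
  "smooth_on U f \<Longrightarrow> x \<in> U \<Longrightarrow> (f has_derivative frechet_derivative f (at x)) (at x)"
  unfolding smooth_on_def by (blast intro: Ck_on_Suc_has_derivative)

lemma smooth_on_frechet_derivative:
  "smooth_on U f \<Longrightarrow> smooth_on U (\<lambda>x. frechet_derivative f (at x) v)"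
  unfolding smooth_on_def by (metis Ck_on.simps(2))

lemma smooth_on_imp_continuous_on: "smooth_on U f \<Longrightarrow> continuous_on U f"
  unfolding smooth_on_def by (blast intro: Ck_on_imp_continuous_on)

lemma smooth_on_subset: "smooth_on U f \<Longrightarrow> V \<subseteq> U \<Longrightarrow> smooth_on V f"
  unfolding smooth_on_def by (blast intro: Ck_on_subset)

lemma smooth_on_const: "smooth_on U (\<lambda>x. c)"
  unfolding smooth_on_def by (blast intro: Ck_on_const)

lemma smooth_on_add: "open U \<Longrightarrow> smooth_on U f \<Longrightarrow> smooth_on U g \<Longrightarrow> smooth_on U (\<lambda>x. f x + g x)"
  unfolding smooth_on_def by (blast intro: Ck_on_add)

lemma smooth_on_mult: "open U \<Longrightarrow> smooth_on U f \<Longrightarrow> smooth_on U g \<Longrightarrow> smooth_on U (\<lambda>x. f x * g x)"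
  unfolding smooth_on_def by (blast intro: Ck_on_mult)

lemma smooth_on_sum:
  "open U \<Longrightarrow> (\<And>i. i \<in> I \<Longrightarrow> smooth_on U (f i)) \<Longrightarrow> smooth_on U (\<lambda>x. \<Sum>i\<in>I. f i x)"
  by (induction I rule: infinite_finite_induct) (auto intro: smooth_on_const smooth_on_add)

lemma smooth_on_inner: "open U \<Longrightarrow> smooth_on U (\<lambda>x. (x - z) \<bullet> b)"
  unfolding smooth_on_def
proof
  fix k assume U: "open U"
  \<comment> \<open>One order more than required, so that the successor rule applies; the derivative
    is constant in \<open>x\<close>.\<close>
  have "Ck_on (Suc k) U (\<lambda>x. (x - z) \<bullet> b)"
    by (rule Ck_on_SucI[OF U, of _ "\<lambda>_ h. h \<bullet> b"])
       (auto intro!: derivative_eq_intros Ck_on_const)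
  then show "Ck_on k U (\<lambda>x. (x - z) \<bullet> b)" by (rule Ck_on_SucD)
qed

text \<open>The radial integral behind the Poincare lemma. Pulling a form of degree
  \<open>n + 1\<close> back along the contraction to \<open>z\<close> and contracting with the
  direction of \<open>t\<close> leaves \<open>n\<close> arguments scaled by \<open>t\<close>, hence
  the weight \<open>t ^ n\<close>.\<close>

definition cone_integral :: "'a::euclidean_space \<Rightarrow> nat \<Rightarrow> ('a \<Rightarrow> real) \<Rightarrow> 'a \<Rightarrow> real" where
  "cone_integral z n f x = integral {0..1} (\<lambda>t. t ^ n * f (z + t *\<^sub>R (x - z)))"

section \<open>Integration along rays in a star-shaped open set\<close>

locale star_domain =
  fixes U :: "'a::euclidean_space set" and z :: 'a
  assumes open_U: "open U"
    and star: "\<And>x t. x \<in> U \<Longrightarrow> t \<in> {0..1} \<Longrightarrow> z + t *\<^sub>R (x - z) \<in> U"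
begin

lemma continuous_on_cone:
  assumes "continuous_on U f"
  shows "continuous_on (U \<times> {0..1}) (\<lambda>(x, t). t ^ n * f (z + t *\<^sub>R (x - z)))"
proof -
  have "continuous_on (U \<times> {0..1}) (\<lambda>p. f (z + snd p *\<^sub>R (fst p - z)))"
    by (rule continuous_on_compose2[OF assms]) (auto intro!: continuous_intros intro: star)
  then show ?thesis unfolding case_prod_beta by (intro continuous_intros)
qed

lemma continuous_on_ray:
  assumes "continuous_on U f" "x \<in> U"
  shows "continuous_on {0..1} (\<lambda>t. t ^ n * f (z + t *\<^sub>R (x - z)))"
proof -
  have "continuous_on {0..1} (\<lambda>t. f (z + t *\<^sub>R (x - z)))"
    by (rule continuous_on_compose2[OF assms(1)]) (auto intro!: continuous_intros intro: star assms)
  then show ?thesis by (intro continuous_intros)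
qed

lemmas integrable_ray = continuous_on_ray[THEN integrable_continuous_real]

text \<open>Differentiation under the integral sign; the chain rule through
  \<open>z + t *\<^sub>R (y - z)\<close> contributes one more factor \<open>t\<close>, which raises
  the weight.\<close>

lemma cone_integral_has_derivative:
  assumes f: "Ck_on (Suc 0) U f" and x: "x \<in> U"
  shows "(cone_integral z n f has_derivative
    (\<lambda>h. cone_integral z (Suc n) (\<lambda>y. frechet_derivative f (at y) h) x)) (at x)"
proof -
  obtain e where e: "e > 0" "ball x e \<subseteq> U"
    using open_U x open_contains_ball by blast
  \<comment> \<open>The Leibniz rule takes the derivative as a bounded linear map.
    \<open>Blinfun\<close> yields the intended one where its argument is bounded linear, in
    particular for \<open>y \<in> U\<close> and \<open>t \<in> {0..1}\<close>.\<close>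
  define L where "L y t = Blinfun (\<lambda>h. t ^ Suc n * frechet_derivative f (at (z + t *\<^sub>R (y - z))) h)"
    for y t
  have df: "(f has_derivative frechet_derivative f (at y)) (at y)" if "y \<in> U" for y
    using f that by (rule Ck_on_Suc_has_derivative)
  have L: "blinfun_apply (L y t) = (\<lambda>h. t ^ Suc n * frechet_derivative f (at (z + t *\<^sub>R (y - z))) h)"
    if "y \<in> U" "t \<in> {0..1}" for y t
    unfolding L_def
    by (intro bounded_linear_Blinfun_apply bounded_linear_const_mult
        has_derivative_bounded_linear[OF df] star that)
  have cont: "continuous_on (U \<times> cbox 0 1) (\<lambda>(y, t). L y t)"
  \<comment> \<open>In finite dimension continuity of \<open>L\<close> can be checked on basis
    vectors, where it is the joint continuity of weighted directional derivatives.\<close>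
  proof (rule continuous_on_blinfun_componentwise)
    fix i :: 'a
    have "continuous_on U (\<lambda>y. frechet_derivative f (at y) i)"
      using f by simp
    from continuous_on_cone[OF this, of "Suc n"]
    show "continuous_on (U \<times> cbox 0 1) (\<lambda>p. blinfun_apply (case p of (y, t) \<Rightarrow> L y t) i)"
      unfolding box_real by (rule continuous_on_eq) (auto simp: L)
  qed
  \<comment> \<open>The Leibniz rule works on a convex set; \<open>U\<close> is only star-shaped, so
    a ball around \<open>x\<close> inside \<open>U\<close> is used.\<close>
  have "((\<lambda>y. integral (cbox 0 1) (\<lambda>t. t ^ n * f (z + t *\<^sub>R (y - z)))) has_derivative
      blinfun_apply (integral (cbox 0 1) (L x))) (at x within ball x e)"
  proof (rule leibniz_rule)
    fix y t assume y: "y \<in> ball x e" and t: "t \<in> cbox 0 (1::real)"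
    then have yU: "y \<in> U" and w: "z + t *\<^sub>R (y - z) \<in> U"
      using e star by auto
    have lin: "linear (frechet_derivative f (at (z + t *\<^sub>R (y - z))))"
      using df[OF w] has_derivative_linear by blast
    have "((\<lambda>y. z + t *\<^sub>R (y - z)) has_derivative (\<lambda>h. t *\<^sub>R h)) (at y within ball x e)"
      by (auto intro!: derivative_eq_intros)
    from has_derivative_compose[OF this df[OF w]]
    have "((\<lambda>y. t ^ n * f (z + t *\<^sub>R (y - z))) has_derivative
        (\<lambda>h. t ^ n * frechet_derivative f (at (z + t *\<^sub>R (y - z))) (t *\<^sub>R h))) (at y within ball x e)"
      by (rule has_derivative_mult_right)
    then show "((\<lambda>y. t ^ n * f (z + t *\<^sub>R (y - z))) has_derivative blinfun_apply (L y t))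
        (at y within ball x e)"
      using t by (simp add: L yU linear_scale[OF lin] mult_ac)
  next
    show "(\<lambda>t. t ^ n * f (z + t *\<^sub>R (y - z))) integrable_on cbox 0 1" if "y \<in> ball x e" for y
      using integrable_ray[OF Ck_on_imp_continuous_on[OF f]] that e(2) by auto
    show "continuous_on (ball x e \<times> cbox 0 1) (\<lambda>(y, t). L y t)"
      using cont by (rule continuous_on_subset) (use e in auto)
  qed (use e in auto)
  then have 1: "(cone_integral z n f has_derivative blinfun_apply (integral (cbox 0 1) (L x))) (at x)"
    using e(1) by (simp add: cone_integral_def[abs_def] at_within_open[of x "ball x e"])
  have "L x integrable_on {0..1}"
    using continuous_on_compose2[OF cont, of "{0..1}" "\<lambda>t. (x, t)"] x
    by (intro integrable_continuous_real) (auto simp: continuous_on_Pair continuous_on_const continuous_on_id)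
  \<comment> \<open>Evaluation at \<open>h\<close> is bounded linear, so it commutes with the
    integral of linear maps.\<close>
  then have "blinfun_apply (integral {0..1} (L x)) h = integral {0..1} (\<lambda>t. blinfun_apply (L x t) h)" for h
    using integral_linear[of "L x" "{0..1}" "\<lambda>l. blinfun_apply l h"]
    by (simp add: o_def bounded_linear_intros)
  also have "integral {0..1} (\<lambda>t. blinfun_apply (L x t) h) =
      cone_integral z (Suc n) (\<lambda>y. frechet_derivative f (at y) h) x" for h
    unfolding cone_integral_def by (intro integral_cong) (simp add: L x)
  finally have "blinfun_apply (integral {0..1} (L x)) =
      (\<lambda>h. cone_integral z (Suc n) (\<lambda>y. frechet_derivative f (at y) h) x)" by blast
  then show ?thesis using 1 by simp
qed

text \<open>A directional derivative of a cone integral is a cone integral of a directional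
  derivative with larger weight, so the induction on \<open>k\<close> lets \<open>n\<close>
  vary.\<close>

lemma Ck_on_cone_integral: "Ck_on k U f \<Longrightarrow> Ck_on k U (cone_integral z n f)"
proof (induction k arbitrary: f n)
  case 0
  then show ?case
    using integral_continuous_on_param[of U 0 1 "\<lambda>x t. t ^ n * f (z + t *\<^sub>R (x - z))"]
      continuous_on_cone[of f n]
    by (simp add: cone_integral_def[abs_def])
next
  case (Suc k)
  have "Ck_on (Suc 0) U f"
    using Suc.prems Ck_on_imp_continuous_on[of k] by auto
  then show ?case
    using Suc.prems by (intro Ck_on_SucI[OF open_U cone_integral_has_derivative] Suc.IH) auto
qed

lemma smooth_on_cone_integral: "smooth_on U f \<Longrightarrow> smooth_on U (cone_integral z n f)"
  unfolding smooth_on_def by (blast intro: Ck_on_cone_integral)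

lemma cone_integral_add:
  assumes "continuous_on U f" "continuous_on U g" "x \<in> U"
  shows "cone_integral z n (\<lambda>y. f y + g y) x = cone_integral z n f x + cone_integral z n g x"
  unfolding cone_integral_def distrib_left
  by (intro integral_add integrable_ray assms)

lemma cone_integral_cmult: "cone_integral z n (\<lambda>y. c * f y) x = c * cone_integral z n f x"
  unfolding cone_integral_def by (subst mult.left_commute) simp

lemma cone_integral_cong:
  assumes "x \<in> U" "\<And>y. y \<in> U \<Longrightarrow> f y = g y"
  shows "cone_integral z n f x = cone_integral z n g x"
  unfolding cone_integral_def by (intro integral_cong) (simp add: assms star)

lemma cone_integral_sum:
  assumes "\<And>i. i \<in> I \<Longrightarrow> continuous_on U (f i)" "x \<in> U"
  shows "cone_integral z n (\<lambda>y. \<Sum>i\<in>I. f i y) x = (\<Sum>i\<in>I. cone_integral z n (f i) x)"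
  using assms(1)
proof (induction I rule: infinite_finite_induct)
  case (insert i I)
  then show ?case
    using cone_integral_add[of "f i" "\<lambda>y. \<Sum>i\<in>I. f i y"] assms(2)
    by (simp add: continuous_on_sum)
qed (simp_all add: cone_integral_def)

text \<open>The integrand is the derivative of \<open>t ^ Suc n * f (z + t *\<^sub>R (x - z))\<close>.\<close>

lemma cone_integral_radial:
  assumes f: "Ck_on (Suc 0) U f" and x: "x \<in> U"
  shows "real (Suc n) * cone_integral z n f x +
    cone_integral z (Suc n) (\<lambda>y. frechet_derivative f (at y) (x - z)) x = f x"
proof -
  have cf: "continuous_on U f"
    using f by (rule Ck_on_imp_continuous_on)
  have cdf: "continuous_on U (\<lambda>y. frechet_derivative f (at y) (x - z))"
    using f by simp
  \<comment> \<open>The exponent \<open>Suc n\<close> is positive, so the boundary term at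
    \<open>0\<close> vanishes and the one at \<open>1\<close> is \<open>f x\<close>.\<close>
  have "((\<lambda>t. real (Suc n) * t ^ n * f (z + t *\<^sub>R (x - z)) +
      t ^ Suc n * frechet_derivative f (at (z + t *\<^sub>R (x - z))) (x - z)) has_integral
      1 ^ Suc n * f (z + 1 *\<^sub>R (x - z)) - 0 ^ Suc n * f (z + 0 *\<^sub>R (x - z))) {0..1}"
  proof (rule fundamental_theorem_of_calculus)
    fix t :: real assume t: "t \<in> {0..1}"
    define D where "D = frechet_derivative f (at (z + t *\<^sub>R (x - z)))"
    have D: "(f has_derivative D) (at (z + t *\<^sub>R (x - z)))"
      unfolding D_def using f star[OF x t] by (rule Ck_on_Suc_has_derivative)
    have "((\<lambda>t. z + t *\<^sub>R (x - z)) has_derivative (\<lambda>s. s *\<^sub>R (x - z))) (at t within {0..1})"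
      by (auto intro!: derivative_eq_intros)
    from has_derivative_compose[OF this D]
    have "((\<lambda>t. f (z + t *\<^sub>R (x - z))) has_derivative (\<lambda>s. D (s *\<^sub>R (x - z)))) (at t within {0..1})" .
    then have "((\<lambda>t. f (z + t *\<^sub>R (x - z))) has_real_derivative D (x - z)) (at t within {0..1})"
      unfolding has_field_derivative_def
      by (simp add: linear_scale[OF has_derivative_linear[OF D]] mult.commute[of _ "D (x - z)"])
    moreover have "((\<lambda>t. t ^ Suc n) has_real_derivative real (Suc n) * t ^ n) (at t within {0..1})"
      using DERIV_pow[of "Suc n"] by simp
    ultimately show "((\<lambda>t. t ^ Suc n * f (z + t *\<^sub>R (x - z))) has_vector_derivative
        real (Suc n) * t ^ n * f (z + t *\<^sub>R (x - z)) + t ^ Suc n * D (x - z)) (at t within {0..1})"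
      unfolding has_real_derivative_iff_has_vector_derivative[symmetric]
      using DERIV_mult by (fastforce simp: add.commute mult.commute)
  qed simp
  then have "f x = integral {0..1} (\<lambda>t. real (Suc n) * (t ^ n * f (z + t *\<^sub>R (x - z))) +
      t ^ Suc n * frechet_derivative f (at (z + t *\<^sub>R (x - z))) (x - z))"
    by (simp add: integral_unique mult.assoc)
  also have "\<dots> = real (Suc n) * cone_integral z n f x +
      cone_integral z (Suc n) (\<lambda>y. frechet_derivative f (at y) (x - z)) x"
    unfolding cone_integral_def
    by (subst integral_add)
       (auto intro!: integrable_on_mult_right integrable_ray[OF cf x, simplified] integrable_ray[OF cdf x, of "Suc n", simplified])
  finally show ?thesis by simp
qed

end

section \<open>Alternating forms\<close>

abbreviation del_nth :: "nat \<Rightarrow> 'b list \<Rightarrow> 'b list" where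
  "del_nth i v \<equiv> take i v @ drop (Suc i) v"

lemma nth_del_nth:
  "i < length v \<Longrightarrow> m < length v - 1 \<Longrightarrow> del_nth i v ! m = (if m < i then v ! m else v ! Suc m)"
  by (auto simp: nth_append min_def)

lemma alternating_form_linear_update:
  "alternating_form p \<eta> \<Longrightarrow> length v = p \<Longrightarrow> i < p \<Longrightarrow> linear (\<lambda>u. \<eta> (v[i := u]))"
  by (simp add: alternating_form_def)

lemma alternating_form_linear:
  assumes "alternating_form p \<eta>" "Suc (length a + length b) = p"
  shows "linear (\<lambda>u. \<eta> (a @ u # b))"
  using alternating_form_linear_update[OF assms(1), of "a @ 0 # b" "length a"] assms(2) by simp

lemma alternating_form_eq_0:
  "alternating_form p \<eta> \<Longrightarrow> length v = p \<Longrightarrow> i < p \<Longrightarrow> j < p \<Longrightarrow> i \<noteq> j \<Longrightarrow> v ! i = v ! j \<Longrightarrow> \<eta> v = 0"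
  unfolding alternating_form_def by blast

text \<open>Polarisation: with \<open>x + y\<close> in both slots the form vanishes, and its
  expansion leaves only the two mixed terms.\<close>

lemma alternating_form_swap:
  assumes \<eta>: "alternating_form p \<eta>" and p: "length (a @ x # y # b) = p"
  shows "\<eta> (a @ x # y # b) = - \<eta> (a @ y # x # b)"
proof -
  have 0: "\<eta> (a @ u # u # b) = 0" for u
    by (rule alternating_form_eq_0[OF \<eta>, of _ "length a" "Suc (length a)"])
       (use p in \<open>auto simp: nth_append\<close>)
  have 1: "\<eta> (a @ (u + w) # c # b) = \<eta> (a @ u # c # b) + \<eta> (a @ w # c # b)" for u w c
    using linear_add[OF alternating_form_linear[OF \<eta>, of a "c # b"]] p by simp
  have 2: "\<eta> (a @ c # (u + w) # b) = \<eta> (a @ c # u # b) + \<eta> (a @ c # w # b)" for u w c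
    using linear_add[OF alternating_form_linear[OF \<eta>, of "a @ [c]" b]] p by simp
  have "\<eta> (a @ (x + y) # (x + y) # b) = \<eta> (a @ x # y # b) + \<eta> (a @ y # x # b)"
    unfolding 1 2 by (simp add: 0)
  then show ?thesis using 0 by simp
qed

text \<open>\<open>x\<close> passes the entries of \<open>b\<close> one at a time, each swap
  flipping the sign; the entries already passed are absorbed into the prefix
  \<open>a\<close>.\<close>

lemma alternating_form_move:
  assumes \<eta>: "alternating_form p \<eta>"
  shows "length (a @ x # b @ c) = p \<Longrightarrow> \<eta> (a @ x # b @ c) = (- 1) ^ length b * \<eta> (a @ b @ x # c)"
proof (induction b arbitrary: a)
  case (Cons y b)
  then show ?case
    using alternating_form_swap[OF \<eta>, of a x y "b @ c"] Cons.IH[of "a @ [y]"] by simp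
qed simp

lemma alternating_form_Cons_del_nth:
  assumes "alternating_form p \<eta>" "length v = p" "i < p"
  shows "\<eta> (v ! i # del_nth i v) = (- 1) ^ i * \<eta> v"
  using alternating_form_move[OF assms(1), of "[]" "v ! i" "take i v" "drop (Suc i) v"] assms
  by (simp add: id_take_nth_drop[symmetric])

text \<open>Contraction with the vector \<open>e\<close>; the homotopy operator contracts with
  \<open>x - z\<close>.\<close>

lemma alternating_form_Cons:
  assumes \<eta>: "alternating_form (Suc p) \<eta>"
  shows "alternating_form p (\<lambda>v. \<eta> (e # v))"
  unfolding alternating_form_def
proof (intro allI impI conjI)
  fix v :: "'a list" and i assume "length v = p" "i < p"
  then show "linear (\<lambda>u. \<eta> (e # v[i := u]))"
    using alternating_form_linear_update[OF \<eta>, of "e # v" "Suc i"] by simp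
next
  fix v :: "'a list" and i j assume "length v = p" "i < p" "j < p" "i \<noteq> j \<and> v ! i = v ! j"
  then show "\<eta> (e # v) = 0"
    by (intro alternating_form_eq_0[OF \<eta>, of _ "Suc i" "Suc j"]) auto
qed

text \<open>The exterior derivative is the case where \<open>A h u\<close> is the directional derivative along \<open>h\<close> of the
  form evaluated at \<open>u\<close>.\<close>

lemma alternating_form_antisymmetrize:
  fixes A :: "'a::real_vector \<Rightarrow> 'a list \<Rightarrow> real"
  assumes alt: "\<And>h. alternating_form p (A h)"
    and lin: "\<And>u. length u = p \<Longrightarrow> linear (\<lambda>h. A h u)"
  shows "alternating_form (Suc p) (\<lambda>v. \<Sum>i<length v. (- 1) ^ i * A (v ! i) (del_nth i v))"
  unfolding alternating_form_def
proof (intro allI impI conjI)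
  fix v :: "'a list" and i assume v: "length v = Suc p" and i: "i < Suc p"
  have "linear (\<lambda>u. A (v[i := u] ! k) (del_nth k (v[i := u])))" if k: "k < Suc p" for k
  proof -
    \<comment> \<open>The updated entry is either the direction (\<open>k = i\<close>) or an
      argument of the form, in slot \<open>i - 1\<close> or \<open>i\<close> according to whether
      the deleted position precedes it.\<close>
    consider "k = i" | "k < i" | "i < k" by linarith
    then show ?thesis
    proof cases
      case 1
      then show ?thesis using v k lin[of "del_nth k v"] by simp
    next
      case 2
      then have "del_nth k (v[i := u]) = (del_nth k v)[i - 1 := u]" for u
        using v k i by (auto simp: list_update_append drop_update_swap)
      then show ?thesis
        using alternating_form_linear_update[OF alt, of "del_nth k v" "i - 1" "v ! k"] 2 v k i by auto
    next
      case 3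
      then have "del_nth k (v[i := u]) = (del_nth k v)[i := u]" for u
        using v k i by (auto simp: list_update_append take_update_swap)
      then show ?thesis
        using alternating_form_linear_update[OF alt, of "del_nth k v" i "v ! k"] 3 v k i by auto
    qed
  qed
  then have "linear (\<lambda>u. (- 1) ^ k * A (v[i := u] ! k) (del_nth k (v[i := u])))" if "k < Suc p" for k
    using linear_compose_scale_right[of _ "(- 1) ^ k :: real"] that by fastforce
  then show "linear (\<lambda>u. \<Sum>k<length (v[i := u]). (- 1) ^ k * A (v[i := u] ! k) (del_nth k (v[i := u])))"
    unfolding length_list_update v by (intro linear_compose_sum) simp
next
  \<comment> \<open>By symmetry \<open>i < j\<close>. Only the summands deleting one of the equal
    entries survive. Their argument lists differ by moving \<open>x\<close> past the
    \<open>j - Suc i\<close> entries in between, and the resulting signs make them cancel.\<close>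
  have main: "(\<Sum>k<length v. (- 1) ^ k * A (v ! k) (del_nth k v)) = 0"
    if v: "length v = Suc p" and i: "i < j" and j: "j < Suc p" and eq: "v ! i = v ! j"
    for v :: "'a list" and i j
  proof -
    \<comment> \<open>Both equal entries survive the deletion, shifted down by one if they stood
      after position \<open>k\<close>.\<close>
    have 0: "A h (del_nth k v) = 0" if k: "k < Suc p" "k \<noteq> i" "k \<noteq> j" for h k
      using k i j v eq
      by (intro alternating_form_eq_0[OF alt, of _ "if i < k then i else i - 1"
            "if j < k then j else j - 1"])
         (auto simp: nth_del_nth simp del: append_take_drop_id)
    define a b c x where "a = take i v" and "b = take (j - Suc i) (drop (Suc i) v)"
      and "c = drop (Suc j) v" and "x = v ! i"
    have vj: "v = take j v @ x # c"
      using id_take_nth_drop[of j v] j v eq by (simp add: c_def x_def)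
    have tj: "take j v = a @ x # b"
      using id_take_nth_drop[of i "take j v"] i j v
      by (simp add: a_def b_def x_def min_def drop_take)
    have veq: "v = a @ x # b @ x # c" using vj tj by simp
    have la: "length a = i" and lb: "length b = j - Suc i"
      using i j v by (auto simp: a_def b_def)
    have di: "del_nth i v = a @ b @ x # c"
      unfolding la[symmetric] by (subst (1 2) veq) simp
    have dj: "del_nth j v = a @ x # b @ c"
      using tj by (simp add: c_def)
    have "A x (del_nth j v) = (- 1) ^ (j - Suc i) * A x (del_nth i v)"
      unfolding di dj lb[symmetric] using arg_cong[OF veq, of length] v
      by (intro alternating_form_move[OF alt]) simp
    moreover have "(- 1) ^ j = - ((- 1) ^ i * (- 1) ^ (j - Suc i) :: real)"
    proof -
      have "j = Suc (i + (j - Suc i))" using i by simp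
      then have "(- 1 :: real) ^ j = (- 1) ^ Suc (i + (j - Suc i))" by (rule arg_cong)
      then show ?thesis by (simp only: power_Suc power_add mult_minus1)
    qed
    ultimately have ij: "(- 1) ^ j * A x (del_nth j v) = - ((- 1) ^ i * A x (del_nth i v))"
      by (simp flip: power_mult_distrib)
    have "(\<Sum>k<length v. (- 1) ^ k * A (v ! k) (del_nth k v)) =
        (\<Sum>k\<in>{i, j}. (- 1) ^ k * A (v ! k) (del_nth k v))"
      using i j v 0 by (intro sum.mono_neutral_right) auto
    then show ?thesis using ij i eq by (simp add: x_def)
  qed
  fix v :: "'a list" and i j
  assume *: "length v = Suc p" "i < Suc p" "j < Suc p" "i \<noteq> j \<and> v ! i = v ! j"
  show "(\<Sum>k<length v. (- 1) ^ k * A (v ! k) (del_nth k v)) = 0"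
    using main[of v i j] main[of v j i] * by (cases "i < j") auto
qed

section \<open>Direction spaces\<close>

text \<open>If \<open>a \<in> S - T\<close>, then of the points \<open>b + s *\<^sub>R a\<close> at most one lies in \<open>T\<close>, so two of them lie in the
  same other subspace, which then contains \<open>b\<close>.\<close>

lemma subspace_subset_finite_Union:
  fixes S :: "'a::real_vector set"
  assumes "finite \<T>" "subspace S" "\<And>T. T \<in> \<T> \<Longrightarrow> subspace T" "S \<subseteq> \<Union>\<T>"
  shows "\<exists>T\<in>\<T>. S \<subseteq> T"
  using assms(1,3,4)
proof (induction \<T> rule: finite_induct)
  case empty
  then show ?case using subspace_0[OF assms(2)] by auto
next
  case (insert T \<T>)
  show ?case
  proof (cases "S \<subseteq> T")
    case False
    then obtain a where a: "a \<in> S" "a \<notin> T" by blast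
    have "b \<in> \<Union>\<T>" if b: "b \<in> S" for b
    proof (rule ccontr)
      assume nb: "b \<notin> \<Union>\<T>"
      have "\<exists>K\<in>insert T \<T>. b + s *\<^sub>R a \<in> K" for s
        using insert.prems(2) b a assms(2) by (meson UnionE subsetD subspace_add subspace_scale)
      then obtain K where K: "\<And>s. K s \<in> insert T \<T> \<and> b + s *\<^sub>R a \<in> K s"
        by metis
      then have "finite (range K)"
        using insert.hyps(1) by (meson finite_insert finite_subset image_subsetI)
      then obtain s where "infinite {t \<in> UNIV. K t = K (s::real)}"
        using pigeonhole_infinite[of UNIV K] infinite_UNIV_char_0 by blast
      then have "infinite ({t. K t = K s} - {s})" by simp
      then obtain t where t: "K t = K s" "t \<noteq> s"
        using infinite_imp_nonempty by blast
      have sub: "subspace (K s)" using K insert.prems(1) by blast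
      have "(b + t *\<^sub>R a) - (b + s *\<^sub>R a) \<in> K s"
        using K[of t] K[of s] t(1) by (intro subspace_diff[OF sub]) auto
      then have "(t - s) *\<^sub>R a \<in> K s"
        by (simp add: scaleR_diff_left)
      from subspace_scale[OF sub this, of "1 / (t - s)"]
      have aK: "a \<in> K s" using t by simp
      then have "K s \<in> \<T>" using a K by blast
      moreover have "(b + s *\<^sub>R a) - s *\<^sub>R a \<in> K s"
        using K aK by (intro subspace_diff subspace_scale sub) auto
      ultimately show False using nb by auto
    qed
    then show ?thesis using insert.IH insert.prems(1) by blast
  qed simp
qed

text \<open>The affine hull is \<open>x\<close> plus this span, so its differences fill exactly the
  span, whichever base point of \<open>\<sigma>\<close> is chosen.\<close>

lemma direction_space_eq_span:
  assumes "x \<in> \<sigma>"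
  shows "direction_space \<sigma> = span ((\<lambda>y. y - x) ` \<sigma>)"
proof -
  have h: "affine hull \<sigma> = (\<lambda>y. x + y) ` span ((\<lambda>y. y - x) ` \<sigma>)"
    using affine_hull_span_gen[of x \<sigma>] assms by (simp add: hull_inc)
  show ?thesis
  proof
    show "direction_space \<sigma> \<subseteq> span ((\<lambda>y. y - x) ` \<sigma>)"
      unfolding direction_space_def h by (auto intro: span_diff)
    show "span ((\<lambda>y. y - x) ` \<sigma>) \<subseteq> direction_space \<sigma>"
    proof
      fix u assume "u \<in> span ((\<lambda>y. y - x) ` \<sigma>)"
      then have "x + u \<in> affine hull \<sigma>" "x \<in> affine hull \<sigma>"
        unfolding h by (auto simp: image_iff intro: span_zero)
      then show "u \<in> direction_space \<sigma>"
        unfolding direction_space_def by (metis (mono_tags, lifting) add_diff_cancel_left' mem_Collect_eq)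
    qed
  qed
qed

lemma subspace_direction_space: "\<sigma> \<noteq> {} \<Longrightarrow> subspace (direction_space \<sigma>)"
  using direction_space_eq_span by fastforce

lemma diff_in_direction_space: "x \<in> \<sigma> \<Longrightarrow> y \<in> \<sigma> \<Longrightarrow> y - x \<in> direction_space \<sigma>"
  using direction_space_eq_span[of x \<sigma>] by (simp add: span_base)

lemma direction_space_mono: "\<sigma> \<subseteq> \<tau> \<Longrightarrow> direction_space \<sigma> \<subseteq> direction_space \<tau>"
  unfolding direction_space_def using hull_mono[of \<sigma> \<tau>] by blast

text \<open>Near \<open>x\<close> only the members of \<open>D\<close> through \<open>x\<close> matter. Each direction \<open>u\<close> of \<open>\<sigma>\<close> gives a short segment
  in \<open>\<sigma>\<close> through a relative interior point, and some member contains two of its points, hence has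
  \<open>u\<close> as a direction. So finitely many direction spaces cover that of \<open>\<sigma>\<close>.\<close>

lemma direction_space_subset_cover:
  fixes \<sigma> :: "'a::euclidean_space set"
  assumes "convex \<sigma>" "x \<in> \<sigma>" "open S" "x \<in> S" "finite D" "\<And>\<tau>. \<tau> \<in> D \<Longrightarrow> closed \<tau>"
    and cover: "\<sigma> \<inter> S \<subseteq> \<Union>D"
  obtains \<tau> where "\<tau> \<in> D" "x \<in> \<tau>" "direction_space \<sigma> \<subseteq> direction_space \<tau>"
proof -
  define S' where "S' = S - \<Union>{\<tau> \<in> D. x \<notin> \<tau>}"
  have S': "open S'" "x \<in> S'"
    unfolding S'_def using assms by (auto intro!: open_Diff closed_Union)
  \<comment> \<open>\<open>x\<close> may lie on the relative boundary. A nearby relative interior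
    point \<open>y\<close> has room in \<open>\<sigma>\<close> for a short segment in every
    direction of \<open>\<sigma>\<close>.\<close>
  have "x \<in> closure (rel_interior \<sigma>)"
    using assms(1,2) closure_subset convex_closure_rel_interior by blast
  then obtain y where y: "y \<in> rel_interior \<sigma>" "y \<in> S'"
    using S' by (meson closure_iff_nhds_not_empty disjoint_iff order_refl)
  then obtain e where e: "e > 0" "ball y e \<inter> affine hull \<sigma> \<subseteq> \<sigma>"
    using mem_rel_interior_ball by blast
  obtain d where d: "d > 0" "ball y d \<subseteq> S'"
    using y S' open_contains_ball by blast
  have y\<sigma>: "y \<in> \<sigma>" using y rel_interior_subset by blast
  have "u \<in> \<Union>(direction_space ` {\<tau> \<in> D. x \<in> \<tau>})" if u: "u \<in> direction_space \<sigma>" for u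
  proof -
    \<comment> \<open>Chosen so that \<open>s < r\<close> gives \<open>s * norm u < min e d\<close>;
      the \<open>+ 1\<close> keeps the denominator positive when \<open>u = 0\<close>.\<close>
    define r where "r = min e d / (norm u + 1)"
    have r: "r > 0" using e d by (simp add: r_def add_nonneg_pos)
    have "\<exists>\<tau>\<in>D. x \<in> \<tau> \<and> y + s *\<^sub>R u \<in> \<tau>" if s: "s \<in> {0<..<r}" for s
    proof -
      have "s * norm u < r * (norm u + 1)"
        using s by (intro mult_strict_mono') auto
      also have "\<dots> = min e d"
        unfolding r_def by (simp add: add_nonneg_eq_0_iff)
      finally have "dist y (y + s *\<^sub>R u) < min e d"
        using s by (simp add: dist_norm)
      moreover have "y + s *\<^sub>R u \<in> affine hull \<sigma>"
        using u y\<sigma> unfolding direction_space_eq_span[OF y\<sigma>]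
        using affine_hull_span_gen[of y \<sigma>] by (auto simp: hull_inc intro: span_scale)
      ultimately have "y + s *\<^sub>R u \<in> \<sigma> \<inter> S'" using e d by auto
      then show ?thesis using cover unfolding S'_def by blast
    qed
    then obtain K where K: "\<And>s. s \<in> {0<..<r} \<Longrightarrow> K s \<in> D \<and> x \<in> K s \<and> y + s *\<^sub>R u \<in> K s"
      by metis
    then have "finite (K ` {0<..<r})"
      using assms(5) by (meson finite_subset image_subsetI)
    then obtain s where s: "s \<in> {0<..<r}" "infinite {t \<in> {0<..<r}. K t = K s}"
      using pigeonhole_infinite[of "{0<..<r}" K] r infinite_Ioo by blast
    then have "infinite ({t \<in> {0<..<r}. K t = K s} - {s})" by simp
    then obtain t where t: "t \<in> {0<..<r}" "K t = K s" "t \<noteq> s"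
      using infinite_imp_nonempty by blast
    have "(y + t *\<^sub>R u) - (y + s *\<^sub>R u) \<in> direction_space (K s)"
      using K[of t] K[of s] s(1) t by (intro diff_in_direction_space) auto
    moreover have sub: "subspace (direction_space (K s))"
      using K s by (intro subspace_direction_space) auto
    ultimately have "(1 / (t - s)) *\<^sub>R (t - s) *\<^sub>R u \<in> direction_space (K s)"
      by (metis add_diff_cancel_left scaleR_diff_left subspace_scale)
    then have "u \<in> direction_space (K s)" using t(3) by simp
    then show ?thesis using K[OF s(1)] by auto
  qed
  moreover have "subspace (direction_space \<sigma>)"
    using assms(2) by (intro subspace_direction_space) auto
  moreover have "finite (direction_space ` {\<tau> \<in> D. x \<in> \<tau>})" using assms(5) by simp
  moreover have "\<And>T. T \<in> direction_space ` {\<tau> \<in> D. x \<in> \<tau>} \<Longrightarrow> subspace T"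
    by (auto intro!: subspace_direction_space)
  ultimately obtain T where "T \<in> direction_space ` {\<tau> \<in> D. x \<in> \<tau>}" "direction_space \<sigma> \<subseteq> T"
    using subspace_subset_finite_Union[of "direction_space ` {\<tau> \<in> D. x \<in> \<tau>}" "direction_space \<sigma>"] by blast
  then show ?thesis using that by blast
qed

section \<open>The homotopy formula\<close>

lemma smooth_form_on_has_derivative:
  "smooth_form_on U p \<omega> \<Longrightarrow> x \<in> U \<Longrightarrow> length u = p \<Longrightarrow>
    ((\<lambda>y. \<omega> y u) has_derivative frechet_derivative (\<lambda>y. \<omega> y u) (at x)) (at x)"
  unfolding smooth_form_on_def by (blast intro: smooth_on_has_derivative)

lemma smooth_form_on_imp_continuous_on:
  "smooth_form_on U p \<omega> \<Longrightarrow> length u = p \<Longrightarrow> continuous_on U (\<lambda>y. \<omega> y u)"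
  unfolding smooth_form_on_def by (blast intro: smooth_on_imp_continuous_on)

lemma smooth_form_on_subset: "smooth_form_on U p \<omega> \<Longrightarrow> V \<subseteq> U \<Longrightarrow> smooth_form_on V p \<omega>"
  unfolding smooth_form_on_def by (blast intro: smooth_on_subset)

lemma frechet_derivative_eqI:
  assumes "(f has_derivative f') (at x)" "open U" "x \<in> U" "\<And>y. y \<in> U \<Longrightarrow> f y = g y"
  shows "frechet_derivative g (at x) = f'"
  using has_derivative_transform_within_open[OF assms] frechet_derivative_at by metis

text \<open>Multilinearity and alternation are identities between functions of the point on all of
  the open set \<open>U\<close>, so they can be differentiated.\<close>

lemma alternating_form_frechet_derivative:
  assumes U: "open U" "x \<in> U" and \<omega>: "smooth_form_on U p \<omega>"
  shows "alternating_form p (\<lambda>u. frechet_derivative (\<lambda>y. \<omega> y u) (at x) h)"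
proof -
  have alt: "alternating_form p (\<omega> y)" if "y \<in> U" for y
    using \<omega> that by (simp add: smooth_form_on_def)
  note D = smooth_form_on_has_derivative[OF \<omega> U(2)]
  show ?thesis
    unfolding alternating_form_def
  proof (intro allI impI conjI linearI)
    fix v :: "'a list" and i u w assume v: "length v = p" and i: "i < p"
    have "frechet_derivative (\<lambda>y. \<omega> y (v[i := u + w])) (at x) =
        (\<lambda>h. frechet_derivative (\<lambda>y. \<omega> y (v[i := u])) (at x) h +
          frechet_derivative (\<lambda>y. \<omega> y (v[i := w])) (at x) h)"
      by (rule frechet_derivative_eqI[OF has_derivative_add[OF D D] U])
         (use v i in \<open>auto simp: linear_add[OF alternating_form_linear_update[OF alt]]\<close>)
    then show "frechet_derivative (\<lambda>y. \<omega> y (v[i := u + w])) (at x) h =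
        frechet_derivative (\<lambda>y. \<omega> y (v[i := u])) (at x) h +
        frechet_derivative (\<lambda>y. \<omega> y (v[i := w])) (at x) h" by simp
  next
    fix v :: "'a list" and i u and c :: real assume v: "length v = p" and i: "i < p"
    have "frechet_derivative (\<lambda>y. \<omega> y (v[i := c *\<^sub>R u])) (at x) =
        (\<lambda>h. c *\<^sub>R frechet_derivative (\<lambda>y. \<omega> y (v[i := u])) (at x) h)"
      by (rule frechet_derivative_eqI[OF has_derivative_scaleR_right[OF D] U])
         (use v i in \<open>auto simp: linear_scale[OF alternating_form_linear_update[OF alt]]\<close>)
    then show "frechet_derivative (\<lambda>y. \<omega> y (v[i := c *\<^sub>R u])) (at x) h =
        c *\<^sub>R frechet_derivative (\<lambda>y. \<omega> y (v[i := u])) (at x) h" by simp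
  next
    fix v :: "'a list" and i j
    assume v: "length v = p" and *: "i < p" "j < p" "i \<noteq> j \<and> v ! i = v ! j"
    have "0 = \<omega> y v" if "y \<in> U" for y
      using alternating_form_eq_0[OF alt[OF that] v *(1,2)] *(3) by simp
    from frechet_derivative_eqI[OF has_derivative_const U this]
    have "frechet_derivative (\<lambda>y. \<omega> y v) (at x) = (\<lambda>h. 0)" .
    then show "frechet_derivative (\<lambda>y. \<omega> y v) (at x) h = 0" by simp
  qed
qed

lemma smooth_form_on_ext_deriv:
  assumes U: "open U" and \<omega>: "smooth_form_on U p \<omega>"
  shows "smooth_form_on U (Suc p) (ext_deriv \<omega>)"
  unfolding smooth_form_on_def
proof (intro conjI ballI allI impI)
  fix x assume x: "x \<in> U"
  have "linear (frechet_derivative (\<lambda>y. \<omega> y u) (at x))" if "length u = p" for u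
    using smooth_form_on_has_derivative[OF \<omega> x that] by (rule has_derivative_linear)
  then show "alternating_form (Suc p) (ext_deriv \<omega> x)"
    unfolding ext_deriv_def[abs_def]
    by (intro alternating_form_antisymmetrize[where
          A = "\<lambda>h u. frechet_derivative (\<lambda>y. \<omega> y u) (at x) h"]
        alternating_form_frechet_derivative[OF U x \<omega>])
next
  fix v :: "'a list" assume "length v = Suc p"
  then show "smooth_on U (\<lambda>x. ext_deriv \<omega> x v)"
    unfolding ext_deriv_def
    by (intro smooth_on_sum smooth_on_mult smooth_on_const smooth_on_frechet_derivative U)
       (use \<omega> in \<open>auto simp: smooth_form_on_def\<close>)
qed

text \<open>Meant for a first argument that varies with the point, such as \<open>x - z\<close>: its
  dependence on the point moves into scalar coefficients.\<close>

lemma alternating_form_Cons_expand: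
  fixes e :: "'a::euclidean_space"
  assumes "alternating_form (Suc n) \<eta>" "length u = n"
  shows "\<eta> (e # u) = (\<Sum>b\<in>Basis. (e \<bullet> b) * \<eta> (b # u))"
proof -
  have lin: "linear (\<lambda>h. \<eta> (h # u))"
    using alternating_form_linear[OF assms(1), of "[]" u] assms(2) by simp
  have "\<eta> (e # u) = \<eta> ((\<Sum>b\<in>Basis. (e \<bullet> b) *\<^sub>R b) # u)"
    by (simp add: euclidean_representation)
  also have "\<dots> = (\<Sum>b\<in>Basis. (e \<bullet> b) * \<eta> (b # u))"
    using linear_sum[OF lin, of "\<lambda>b. (e \<bullet> b) *\<^sub>R b" Basis] linear_scale[OF lin] by simp
  finally show ?thesis .
qed

text \<open>The homotopy operator of the Poincare lemma, from degree \<open>n + 1\<close> to degree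
  \<open>n\<close>. The contracting vector is the velocity \<open>x - z\<close> of the ray, constant
  along it, and not \<open>y - z\<close>.\<close>

definition cone_form ::
    "'a::euclidean_space \<Rightarrow> nat \<Rightarrow> ('a \<Rightarrow> 'a list \<Rightarrow> real) \<Rightarrow> 'a \<Rightarrow> 'a list \<Rightarrow> real" where
  "cone_form z n \<omega> x u = cone_integral z n (\<lambda>y. \<omega> y ((x - z) # u)) x"

section \<open>The homotopy operator on a star-shaped open set\<close>

context star_domain
begin

lemma alternating_form_cone_integral:
  fixes \<omega> :: "'a \<Rightarrow> 'a list \<Rightarrow> real"
  assumes \<omega>: "\<And>y. y \<in> U \<Longrightarrow> alternating_form p (\<omega> y)"
    and cont: "\<And>u. length u = p \<Longrightarrow> continuous_on U (\<lambda>y. \<omega> y u)" and x: "x \<in> U"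
  shows "alternating_form p (\<lambda>u. cone_integral z n (\<lambda>y. \<omega> y u) x)"
  unfolding alternating_form_def
proof (intro allI impI conjI linearI)
  fix v :: "'a list" and i u w assume v: "length v = p" and i: "i < p"
  have "cone_integral z n (\<lambda>y. \<omega> y (v[i := u + w])) x =
      cone_integral z n (\<lambda>y. \<omega> y (v[i := u]) + \<omega> y (v[i := w])) x"
    using linear_add[OF alternating_form_linear_update[OF \<omega>]] v i x
    by (intro cone_integral_cong) auto
  then show "cone_integral z n (\<lambda>y. \<omega> y (v[i := u + w])) x =
      cone_integral z n (\<lambda>y. \<omega> y (v[i := u])) x + cone_integral z n (\<lambda>y. \<omega> y (v[i := w])) x"
    using v x by (simp add: cone_integral_add cont)
next
  fix v :: "'a list" and i u and c :: real assume v: "length v = p" and i: "i < p"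
  have "cone_integral z n (\<lambda>y. \<omega> y (v[i := c *\<^sub>R u])) x =
      cone_integral z n (\<lambda>y. c * \<omega> y (v[i := u])) x"
    using linear_scale[OF alternating_form_linear_update[OF \<omega>]] v i x
    by (intro cone_integral_cong) auto
  then show "cone_integral z n (\<lambda>y. \<omega> y (v[i := c *\<^sub>R u])) x =
      c *\<^sub>R cone_integral z n (\<lambda>y. \<omega> y (v[i := u])) x"
    by (simp add: cone_integral_cmult)
next
  fix v :: "'a list" and i j
  assume v: "length v = p" and *: "i < p" "j < p" "i \<noteq> j \<and> v ! i = v ! j"
  have "cone_integral z n (\<lambda>y. \<omega> y v) x = cone_integral z n (\<lambda>y. 0) x"
    using v * x by (intro cone_integral_cong) (auto intro: alternating_form_eq_0[OF \<omega>])
  then show "cone_integral z n (\<lambda>y. \<omega> y v) x = 0"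
    by (simp add: cone_integral_def)
qed

lemma cone_integral_Cons_expand:
  fixes \<omega> :: "'a \<Rightarrow> 'a list \<Rightarrow> real"
  assumes \<omega>: "\<And>y. y \<in> U \<Longrightarrow> alternating_form (Suc k) (\<omega> y)"
    and cont: "\<And>u. length u = Suc k \<Longrightarrow> continuous_on U (\<lambda>y. \<omega> y u)"
    and x: "x \<in> U" and u: "length u = k"
  shows "cone_integral z n (\<lambda>y. \<omega> y (e # u)) x =
    (\<Sum>b\<in>Basis. (e \<bullet> b) * cone_integral z n (\<lambda>y. \<omega> y (b # u)) x)"
proof (rule alternating_form_Cons_expand[where \<eta> = "\<lambda>u. cone_integral z n (\<lambda>y. \<omega> y u) x", OF _ u])
  show "alternating_form (Suc k) (\<lambda>u. cone_integral z n (\<lambda>y. \<omega> y u) x)"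
    using \<omega> cont x by (rule alternating_form_cone_integral)
qed

text \<open>The point \<open>x\<close> enters both as the end of the ray and through the contracting
  vector. The basis expansion separates the two, leaving cone integrals with constant
  arguments.\<close>

lemma cone_form_eq:
  assumes \<omega>: "smooth_form_on U (Suc n) \<omega>" and u: "length u = n" and x: "x \<in> U"
  shows "cone_form z n \<omega> x u =
    (\<Sum>b\<in>Basis. ((x - z) \<bullet> b) * cone_integral z n (\<lambda>y. \<omega> y (b # u)) x)"
  unfolding cone_form_def
  by (rule cone_integral_Cons_expand)
     (use \<omega> u x smooth_form_on_imp_continuous_on[OF \<omega>] in \<open>auto simp: smooth_form_on_def\<close>)

lemma smooth_form_on_cone_form:
  assumes \<omega>: "smooth_form_on U (Suc n) \<omega>"
  shows "smooth_form_on U n (cone_form z n \<omega>)"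
  unfolding smooth_form_on_def
proof (intro conjI ballI allI impI)
  fix x assume x: "x \<in> U"
  show "alternating_form n (cone_form z n \<omega> x)"
    unfolding cone_form_def[abs_def]
    by (rule alternating_form_cone_integral)
       (use \<omega> x in \<open>auto simp: smooth_form_on_def alternating_form_Cons intro: smooth_on_imp_continuous_on\<close>)
next
  fix u :: "'a list" assume u: "length u = n"
  have "smooth_on U (\<lambda>x. \<Sum>b\<in>Basis. ((x - z) \<bullet> b) * cone_integral z n (\<lambda>y. \<omega> y (b # u)) x)"
    by (intro smooth_on_sum smooth_on_mult smooth_on_inner smooth_on_cone_integral open_U)
       (use \<omega> u in \<open>auto simp: smooth_form_on_def\<close>)
  then show "smooth_on U (\<lambda>x. cone_form z n \<omega> x u)"
    by (rule smooth_on_cong[OF open_U]) (simp add: cone_form_eq[OF \<omega> u])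
qed

text \<open>Product rule in the basis expansion, with both sums folded back afterwards: the first
  term differentiates the coefficients, the second the integrals, with \<open>x - z\<close> held
  fixed.\<close>

lemma frechet_derivative_cone_form:
  assumes \<omega>: "smooth_form_on U (Suc n) \<omega>" and u: "length u = n" and x: "x \<in> U"
  shows "frechet_derivative (\<lambda>x. cone_form z n \<omega> x u) (at x) h =
    cone_integral z n (\<lambda>y. \<omega> y (h # u)) x +
    cone_integral z (Suc n) (\<lambda>y. frechet_derivative (\<lambda>y. \<omega> y ((x - z) # u)) (at y) h) x"
proof -
  have sm: "smooth_on U (\<lambda>y. \<omega> y v)" if "length v = Suc n" for v
    using \<omega> that by (simp add: smooth_form_on_def)
  have "((\<lambda>x. \<Sum>b\<in>Basis. ((x - z) \<bullet> b) * cone_integral z n (\<lambda>y. \<omega> y (b # u)) x) has_derivative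
      (\<lambda>h. \<Sum>b\<in>Basis. ((x - z) \<bullet> b) *
          cone_integral z (Suc n) (\<lambda>y. frechet_derivative (\<lambda>y. \<omega> y (b # u)) (at y) h) x +
        (h \<bullet> b) * cone_integral z n (\<lambda>y. \<omega> y (b # u)) x)) (at x)"
  proof (intro has_derivative_sum has_derivative_mult cone_integral_has_derivative x)
    fix b
    show "((\<lambda>x. (x - z) \<bullet> b) has_derivative (\<lambda>h. h \<bullet> b)) (at x)"
      by (auto intro!: derivative_eq_intros)
    show "Ck_on (Suc 0) U (\<lambda>y. \<omega> y (b # u))"
      using sm[of "b # u"] u unfolding smooth_on_def length_Cons by blast
  qed
  from frechet_derivative_eqI[OF this open_U x cone_form_eq[OF \<omega> u, symmetric]]
  have "frechet_derivative (\<lambda>x. cone_form z n \<omega> x u) (at x) h =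
      (\<Sum>b\<in>Basis. (h \<bullet> b) * cone_integral z n (\<lambda>y. \<omega> y (b # u)) x) +
      (\<Sum>b\<in>Basis. ((x - z) \<bullet> b) *
          cone_integral z (Suc n) (\<lambda>y. frechet_derivative (\<lambda>y. \<omega> y (b # u)) (at y) h) x)"
    by (simp add: sum.distrib)
  also have "(\<Sum>b\<in>Basis. (h \<bullet> b) * cone_integral z n (\<lambda>y. \<omega> y (b # u)) x) =
      cone_integral z n (\<lambda>y. \<omega> y (h # u)) x"
    by (rule cone_integral_Cons_expand[symmetric])
       (use \<omega> u x smooth_form_on_imp_continuous_on[OF \<omega>] in \<open>auto simp: smooth_form_on_def\<close>)
  also have "(\<Sum>b\<in>Basis. ((x - z) \<bullet> b) *
        cone_integral z (Suc n) (\<lambda>y. frechet_derivative (\<lambda>y. \<omega> y (b # u)) (at y) h) x) =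
      cone_integral z (Suc n) (\<lambda>y. frechet_derivative (\<lambda>y. \<omega> y ((x - z) # u)) (at y) h) x"
    by (rule cone_integral_Cons_expand[symmetric,
          where \<omega> = "\<lambda>y u. frechet_derivative (\<lambda>y. \<omega> y u) (at y) h"])
       (use u x alternating_form_frechet_derivative[OF open_U _ \<omega>]
          smooth_on_imp_continuous_on[OF smooth_on_frechet_derivative[OF sm]] in auto)
  finally show ?thesis .
qed

text \<open>The homotopy formula. The terms differentiating along some \<open>v ! i\<close> with
  \<open>x - z\<close> inserted occur in both compositions with opposite signs. What remains is
  \<open>Suc n\<close> times the integral of \<open>\<omega>\<close> plus its radial derivative
  term, and these add up to \<open>\<omega> x v\<close>.\<close>

lemma ext_deriv_cone_form:
  assumes \<omega>: "smooth_form_on U (Suc n) \<omega>" and v: "length v = Suc n" and x: "x \<in> U"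
  shows "ext_deriv (cone_form z n \<omega>) x v = \<omega> x v - cone_form z (Suc n) (ext_deriv \<omega>) x v"
proof -
  define D where "D y h u = frechet_derivative (\<lambda>y. \<omega> y u) (at y) h" for y h u
  define e where "e = x - z"
  have sm: "smooth_on U (\<lambda>y. \<omega> y u)" if "length u = Suc n" for u
    using \<omega> that by (simp add: smooth_form_on_def)
  have cont: "continuous_on U (\<lambda>y. \<omega> y u)" if "length u = Suc n" for u
    using sm[OF that] by (rule smooth_on_imp_continuous_on)
  have contD: "continuous_on U (\<lambda>y. D y h u)" if "length u = Suc n" for h u
    unfolding D_def using sm[OF that] smooth_on_imp_continuous_on smooth_on_frechet_derivative by blast
  have lin: "(\<Sum>i<Suc n. (- 1) ^ i * cone_integral z m (f i) x) =
      cone_integral z m (\<lambda>y. \<Sum>i<Suc n. (- 1) ^ i * f i y) x"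
    if "\<And>i. i < Suc n \<Longrightarrow> continuous_on U (f i)" for m and f :: "nat \<Rightarrow> 'a \<Rightarrow> real"
    by (subst cone_integral_sum) (use that x in \<open>auto simp: cone_integral_cmult intro: continuous_intros\<close>)
  have len: "length (v ! i # del_nth i v) = Suc n" "length (e # del_nth i v) = Suc n"
    if "i < Suc n" for i using v that by auto
  have "ext_deriv (cone_form z n \<omega>) x v = (\<Sum>i<Suc n. (- 1) ^ i *
      (cone_integral z n (\<lambda>y. \<omega> y (v ! i # del_nth i v)) x +
       cone_integral z (Suc n) (\<lambda>y. D y (v ! i) (e # del_nth i v)) x))"
    unfolding ext_deriv_def v D_def e_def
    by (intro sum.cong refl arg_cong2[where f = "(*)"] frechet_derivative_cone_form[OF \<omega> _ x])
       (use v in auto)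
  also have "\<dots> = cone_integral z n (\<lambda>y. \<Sum>i<Suc n. (- 1) ^ i * \<omega> y (v ! i # del_nth i v)) x +
      cone_integral z (Suc n) (\<lambda>y. \<Sum>i<Suc n. (- 1) ^ i * D y (v ! i) (e # del_nth i v)) x"
    unfolding distrib_left sum.distrib by (intro arg_cong2[where f = "(+)"] lin cont contD len)
  \<comment> \<open>Moving \<open>v ! i\<close> back to its place gives a sign that cancels the one
    present, so all \<open>Suc n\<close> summands equal \<open>\<omega> y v\<close>.\<close>
  also have "cone_integral z n (\<lambda>y. \<Sum>i<Suc n. (- 1) ^ i * \<omega> y (v ! i # del_nth i v)) x =
      cone_integral z n (\<lambda>y. real (Suc n) * \<omega> y v) x"
  proof (rule cone_integral_cong[OF x])
    fix y assume "y \<in> U"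
    then have "alternating_form (Suc n) (\<omega> y)" using \<omega> by (simp add: smooth_form_on_def)
    from alternating_form_Cons_del_nth[OF this v]
    have "(\<Sum>i<Suc n. (- 1) ^ i * \<omega> y (v ! i # del_nth i v)) = (\<Sum>i<Suc n. \<omega> y v)"
      by (intro sum.cong) (auto simp flip: mult.assoc power_mult_distrib)
    then show "(\<Sum>i<Suc n. (- 1) ^ i * \<omega> y (v ! i # del_nth i v)) = real (Suc n) * \<omega> y v"
      by simp
  qed
  also have "\<dots> = real (Suc n) * cone_integral z n (\<lambda>y. \<omega> y v) x"
    by (rule cone_integral_cmult)
  also have "\<dots> = \<omega> x v - cone_integral z (Suc n) (\<lambda>y. D y e v) x"
    using cone_integral_radial[of "\<lambda>y. \<omega> y v" x n] sm[OF v] x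
    unfolding smooth_on_def D_def e_def by (simp del: Ck_on.simps(2))
  also have "\<dots> + cone_integral z (Suc n) (\<lambda>y. \<Sum>i<Suc n. (- 1) ^ i * D y (v ! i) (e # del_nth i v)) x =
      \<omega> x v - cone_integral z (Suc n) (\<lambda>y. ext_deriv \<omega> y (e # v)) x"
  proof -
    \<comment> \<open>Index \<open>0\<close> differentiates along \<open>e\<close>. The other
      indices are shifted by one because \<open>e\<close> occupies the first slot, whence the factor
      \<open>- 1\<close>.\<close>
    have "ext_deriv \<omega> y (e # v) = D y e v + (- 1) * (\<Sum>i<Suc n. (- 1) ^ i * D y (v ! i) (e # del_nth i v))" for y
      unfolding ext_deriv_def length_Cons v D_def
      by (subst sum.lessThan_Suc_shift) (simp add: sum_negf del: sum.lessThan_Suc)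
    then have "cone_integral z (Suc n) (\<lambda>y. ext_deriv \<omega> y (e # v)) x =
      cone_integral z (Suc n) (\<lambda>y. D y e v) x + (- 1) *
        cone_integral z (Suc n) (\<lambda>y. \<Sum>i<Suc n. (- 1) ^ i * D y (v ! i) (e # del_nth i v)) x"
      unfolding cone_integral_cmult[symmetric]
      by (simp only:) (intro cone_integral_add x contD v continuous_intros len, auto)
    then show ?thesis by simp
  qed
  finally show ?thesis unfolding cone_form_def e_def .
qed

end

section \<open>Superforms on open subsets of Euclidean space\<close>

lemma superform_onE:
  assumes "superform_on U p q \<alpha>"
  obtains m :: nat and \<omega> \<eta> where "\<And>k. k < m \<Longrightarrow> smooth_form_on U p (\<omega> k)"
    "\<And>k. k < m \<Longrightarrow> alternating_form q (\<eta> k)"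
    "\<And>x v w. \<lbrakk>x \<in> U; length v = p; length w = q\<rbrakk> \<Longrightarrow> \<alpha> x v w = (\<Sum>k<m. \<omega> k x v * \<eta> k w)"
proof -
  from assms obtain m \<omega> \<eta> where
    "\<forall>k<m::nat. smooth_form_on U p (\<omega> k) \<and> alternating_form q (\<eta> k)"
    "\<forall>x\<in>U. \<forall>v w. length v = p \<and> length w = q \<longrightarrow> \<alpha> x v w = (\<Sum>k<m. \<omega> k x v * \<eta> k w)"
    unfolding superform_on_def by blast
  then show thesis by (intro that[of m \<omega> \<eta>]) auto
qed

lemma superform_on_subset:
  assumes "superform_on U p q \<alpha>" "V \<subseteq> U"
  shows "superform_on V p q \<alpha>"
  using assms(1)
proof (cases rule: superform_onE)
  case *: (1 m \<omega> \<eta>)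
  show ?thesis
    unfolding superform_on_def
    by (intro exI[of _ m] exI[of _ \<omega>] exI[of _ \<eta>] conjI allI impI ballI
        smooth_form_on_subset[OF *(1) assms(2)] *(2,3)) (use assms(2) in auto)
qed

lemma superform_on_differentiable:
  assumes "open U" "superform_on U p q \<alpha>" "x \<in> U" "length v = p" "length w = q"
  shows "(\<lambda>y. \<alpha> y v w) differentiable (at x)"
  using assms(2)
proof (cases rule: superform_onE)
  case *: (1 m \<omega> \<eta>)
  have "((\<lambda>y. \<Sum>k<m. \<omega> k y v * \<eta> k w) has_derivative
      (\<lambda>h. \<Sum>k<m. frechet_derivative (\<lambda>y. \<omega> k y v) (at x) h * \<eta> k w)) (at x)"
    by (intro has_derivative_sum has_derivative_mult_left smooth_form_on_has_derivative[OF *(1)])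
       (use assms in auto)
  then show ?thesis
    unfolding differentiable_def
    by (intro exI, rule has_derivative_transform_within_open[OF _ assms(1,3)]) (simp add: *(3) assms)
qed

lemma superform_on_dprime:
  assumes U: "open U" and \<alpha>: "superform_on U p q \<alpha>"
  shows "superform_on U (Suc p) q (dprime \<alpha>)"
  using \<alpha>
proof (cases rule: superform_onE)
  case *: (1 m \<omega> \<eta>)
  have "dprime \<alpha> x v w = (\<Sum>k<m. ext_deriv (\<omega> k) x v * \<eta> k w)"
    if "x \<in> U" "length v = Suc p" "length w = q" for x v w
    by (rule dprime_tensor[OF U that(1) *(1) *(3) that(2,3)])
  then show ?thesis
    unfolding superform_on_def
    by (intro exI[of _ m] exI[of _ "\<lambda>k. ext_deriv (\<omega> k)"] exI[of _ \<eta>])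
       (auto intro: smooth_form_on_ext_deriv[OF U] *(1,2))
qed

text \<open>The homotopy operator acts on the first tensor factors only. The error term is expressed
  through values of \<open>dprime \<alpha>\<close> along the ray, so that its vanishing on suitable
  directions can be used pointwise.\<close>

lemma (in star_domain) superform_homotopy:
  assumes \<alpha>: "superform_on U (Suc n) q \<alpha>"
  obtains \<beta> where "superform_on U n q \<beta>"
    "\<And>x v w. \<lbrakk>x \<in> U; length v = Suc n; length w = q\<rbrakk> \<Longrightarrow>
      dprime \<beta> x v w = \<alpha> x v w - cone_integral z (Suc n) (\<lambda>y. dprime \<alpha> y ((x - z) # v) w) x"
  using \<alpha>
proof (cases rule: superform_onE)
  case *: (1 m \<omega> \<eta>)
  define \<beta> where "\<beta> x v w = (\<Sum>k<m. cone_form z n (\<omega> k) x v * \<eta> k w)" for x v w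
  show ?thesis
  proof
    show "superform_on U n q \<beta>"
      unfolding superform_on_def \<beta>_def
      by (intro exI[of _ m] exI[of _ "\<lambda>k. cone_form z n (\<omega> k)"] exI[of _ \<eta>])
         (auto intro: smooth_form_on_cone_form *(1,2))
    fix x and v w :: "'a list" assume x: "x \<in> U" and v: "length v = Suc n" and w: "length w = q"
    have "dprime \<beta> x v w = (\<Sum>k<m. ext_deriv (cone_form z n (\<omega> k)) x v * \<eta> k w)"
      by (rule dprime_tensor[OF open_U x smooth_form_on_cone_form[OF *(1)] _ v w])
         (simp_all add: \<beta>_def)
    also have "\<dots> = \<alpha> x v w - (\<Sum>k<m. \<eta> k w * cone_form z (Suc n) (ext_deriv (\<omega> k)) x v)"
      using *(1) x v w by (simp add: ext_deriv_cone_form *(3) right_diff_distrib sum_subtractf mult.commute)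
    also have "(\<Sum>k<m. \<eta> k w * cone_form z (Suc n) (ext_deriv (\<omega> k)) x v) =
        cone_integral z (Suc n) (\<lambda>y. \<Sum>k<m. \<eta> k w * ext_deriv (\<omega> k) y ((x - z) # v)) x"
      unfolding cone_form_def cone_integral_cmult[symmetric]
    proof (rule cone_integral_sum[symmetric, OF _ x])
      fix k assume "k \<in> {..<m}"
      then have "smooth_form_on U (Suc (Suc n)) (ext_deriv (\<omega> k))"
        by (auto intro: smooth_form_on_ext_deriv[OF open_U] *(1))
      then show "continuous_on U (\<lambda>y. \<eta> k w * ext_deriv (\<omega> k) y ((x - z) # v))"
        using v by (intro continuous_intros) (auto intro: smooth_form_on_imp_continuous_on)
    qed
    also have "\<dots> = cone_integral z (Suc n) (\<lambda>y. dprime \<alpha> y ((x - z) # v) w) x"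
    proof (rule cone_integral_cong[OF x])
      fix y assume "y \<in> U"
      from dprime_tensor[OF open_U this *(1) *(3), where v = "(x - z) # v" and w = w] v w
      show "(\<Sum>k<m. \<eta> k w * ext_deriv (\<omega> k) y ((x - z) # v)) = dprime \<alpha> y ((x - z) # v) w"
        by (simp add: mult.commute)
    qed
    finally show "dprime \<beta> x v w =
        \<alpha> x v w - cone_integral z (Suc n) (\<lambda>y. dprime \<alpha> y ((x - z) # v) w) x" .
  qed
qed

text \<open>At a boundary point of \<open>\<sigma>\<close> one compares one-sided derivatives towards the points of \<open>\<sigma>\<close>; these
  directions span the direction space.\<close>

lemma derivative_eq_on_direction_space:
  fixes f g :: "'a::real_normed_vector \<Rightarrow> real"
  assumes \<sigma>: "convex \<sigma>" "x \<in> \<sigma>" and N: "open N" "x \<in> N"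
    and eq: "\<And>y. y \<in> \<sigma> \<inter> N \<Longrightarrow> f y = g y"
    and f: "(f has_derivative f') (at x)" and g: "(g has_derivative g') (at x)"
    and h: "h \<in> direction_space \<sigma>"
  shows "f' h = g' h"
proof -
  note lf = has_derivative_linear[OF f] and lg = has_derivative_linear[OF g]
  have "f' b = g' b" if b: "b \<in> (\<lambda>y. y - x) ` \<sigma>" for b
  proof -
    obtain y where y: "y \<in> \<sigma>" "b = y - x" using b by blast
    define \<phi> where "\<phi> s = f (x + s *\<^sub>R b) - g (x + s *\<^sub>R b)" for s :: real
    have path: "((\<lambda>s. x + s *\<^sub>R b) has_derivative (\<lambda>s. s *\<^sub>R b)) (at 0 within {0<..})"
      by (auto intro!: derivative_eq_intros)
    have "(\<phi> has_derivative (\<lambda>s. f' (s *\<^sub>R b) - g' (s *\<^sub>R b))) (at 0 within {0<..})"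
      unfolding \<phi>_def using f g
      by (intro has_derivative_diff has_derivative_compose[OF path]) auto
    also have "(\<lambda>s. f' (s *\<^sub>R b) - g' (s *\<^sub>R b)) = (*) (f' b - g' b)"
      by (simp add: fun_eq_iff linear_scale[OF lf] linear_scale[OF lg] algebra_simps)
    finally have "(\<phi> has_field_derivative (f' b - g' b)) (at_right 0)"
      unfolding has_field_derivative_def .
    then have 1: "((\<lambda>s. (\<phi> s - \<phi> 0) / (s - 0)) \<longlongrightarrow> f' b - g' b) (at_right 0)"
      by (simp add: has_field_derivative_iff)
    have "((\<lambda>s. x + s *\<^sub>R b) \<longlongrightarrow> x + 0 *\<^sub>R b) (at_right (0::real))"
      by (intro tendsto_intros)
    then have "eventually (\<lambda>s. x + s *\<^sub>R b \<in> N) (at_right (0::real))"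
      using N by (intro topological_tendstoD) auto
    moreover have "eventually (\<lambda>s. s \<in> {0<..<1}) (at_right (0::real))"
      by (rule eventually_at_right_real) simp
    \<comment> \<open>For small \<open>s > 0\<close> the point \<open>x + s *\<^sub>R b\<close> lies
      on the segment from \<open>x\<close> to \<open>y\<close> and in \<open>N\<close>, where
      \<open>f\<close> and \<open>g\<close> agree, so \<open>\<phi>\<close> vanishes there and at
      \<open>0\<close>.\<close>
    ultimately have "eventually (\<lambda>s. (\<phi> s - \<phi> 0) / (s - 0) = 0) (at_right 0)"
    proof eventually_elim
      case (elim s)
      have "(1 - s) *\<^sub>R x + s *\<^sub>R y \<in> \<sigma>"
        using \<sigma> y elim by (intro convexD) auto
      then have "x + s *\<^sub>R b \<in> \<sigma>" unfolding y(2) by (simp add: algebra_simps)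
      then show ?case using elim eq \<sigma> N by (simp add: \<phi>_def)
    qed
    then have "((\<lambda>s. (\<phi> s - \<phi> 0) / (s - 0)) \<longlongrightarrow> 0) (at_right 0)"
      by (rule tendsto_eventually)
    from tendsto_unique[OF _ 1 this] show ?thesis by simp
  qed
  then show ?thesis
    using linear_eq_on_span[OF lf lg] h direction_space_eq_span[OF \<sigma>(2)] by blast
qed

text \<open>In each summand both the direction of differentiation and the remaining arguments lie in
  the direction space, so only values tangent to \<open>\<sigma>\<close> at points of
  \<open>\<sigma>\<close> enter.\<close>

lemma dprime_eq_on_direction_space:
  fixes \<alpha> \<beta> :: "'a::euclidean_space superform"
  assumes \<sigma>: "convex \<sigma>" "x \<in> \<sigma>"
    and U: "open U" "x \<in> U" "superform_on U p q \<alpha>"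
    and V: "open V" "x \<in> V" "superform_on V p q \<beta>"
    and eq: "\<And>y v w. \<lbrakk>y \<in> \<sigma> \<inter> U \<inter> V; length v = p; length w = q;
      set v \<subseteq> direction_space \<sigma>; set w \<subseteq> direction_space \<sigma>\<rbrakk> \<Longrightarrow> \<alpha> y v w = \<beta> y v w"
    and v: "length v = Suc p" "set v \<subseteq> direction_space \<sigma>"
    and w: "length w = q" "set w \<subseteq> direction_space \<sigma>"
  shows "dprime \<alpha> x v w = dprime \<beta> x v w"
  unfolding dprime_def ext_deriv_def
proof (intro sum.cong refl arg_cong2[where f = "(*)"])
  fix i assume "i \<in> {..<length v}"
  then have i: "i < length v" by simp
  have del: "length (del_nth i v) = p" "set (del_nth i v) \<subseteq> direction_space \<sigma>"
    using v i by (auto dest: in_set_takeD in_set_dropD)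
  show "frechet_derivative (\<lambda>y. \<alpha> y (del_nth i v) w) (at x) (v ! i) =
      frechet_derivative (\<lambda>y. \<beta> y (del_nth i v) w) (at x) (v ! i)"
  proof (rule derivative_eq_on_direction_space[OF \<sigma>])
    show "open (U \<inter> V)" "x \<in> U \<inter> V" using U V by auto
    show "v ! i \<in> direction_space \<sigma>" using v i by (meson nth_mem subsetD)
    show "\<alpha> y (del_nth i v) w = \<beta> y (del_nth i v) w" if "y \<in> \<sigma> \<inter> (U \<inter> V)" for y
      by (rule eq) (use that del w in auto)
    show "((\<lambda>y. \<alpha> y (del_nth i v) w) has_derivative
        frechet_derivative (\<lambda>y. \<alpha> y (del_nth i v) w) (at x)) (at x)"
      using superform_on_differentiable[OF U(1,3,2) del(1) w(1)] by (simp add: frechet_derivative_works)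
    show "((\<lambda>y. \<beta> y (del_nth i v) w) has_derivative
        frechet_derivative (\<lambda>y. \<beta> y (del_nth i v) w) (at x)) (at x)"
      using superform_on_differentiable[OF V(1,3,2) del(1) w(1)] by (simp add: frechet_derivative_works)
  qed
qed

section \<open>Superforms on polyhedral complexes\<close>

lemma ex_maximal_in_superset:
  assumes "finite D" "\<sigma> \<in> D"
  obtains \<tau> where "maximal_in D \<tau>" "\<sigma> \<subseteq> \<tau>"
proof -
  obtain \<tau> where "\<tau> \<in> D" "\<sigma> \<subseteq> \<tau>" "\<forall>b\<in>D. \<tau> \<subseteq> b \<longrightarrow> \<tau> = b"
    using finite_has_maximal2[OF assms] by blast
  then show thesis by (intro that[of \<tau>]) (auto simp: maximal_in_def)
qed

text \<open>The complement is the projection of a closed set along the compact interval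
  \<open>{0..1}\<close>, hence closed.\<close>

lemma open_star_core:
  fixes z :: "'a::euclidean_space"
  assumes "open V"
  shows "open {x. \<forall>t\<in>{0..1}. z + t *\<^sub>R (x - z) \<in> V}"
proof -
  define T where "T = (\<lambda>p. z + fst p *\<^sub>R (snd p - z)) -` (- V)"
  have "closed T"
    unfolding T_def using assms by (intro closed_vimage continuous_intros) auto
  then have "closed {x. \<exists>t::real. t \<in> {0..1} \<and> (t, x) \<in> T}"
    by (intro closed_compact_projection) auto
  moreover have "{x. \<forall>t\<in>{0..1}. z + t *\<^sub>R (x - z) \<in> V} = - {x. \<exists>t. t \<in> {0..1} \<and> (t, x) \<in> T}"
    by (auto simp: T_def)
  ultimately show ?thesis by (simp add: open_closed)
qed

lemma polyhedral_complex_convex: "polyhedral_complex C \<Longrightarrow> \<sigma> \<in> C \<Longrightarrow> convex \<sigma>"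
  by (simp add: polyhedral_complex_def polyhedron_imp_convex)

text \<open>Near \<open>x\<close> the polyhedron \<open>\<sigma>\<close> lies in
  \<open>\<Omega>\<close> and is therefore covered by \<open>D\<close>. The main proof applies this
  from \<open>C\<close> to \<open>D\<close> and from \<open>D\<close> to \<open>C\<close>.\<close>

lemma direction_space_subset_other_complex:
  assumes C: "polyhedral_complex C" "openin (top_of_set (\<Union>C)) \<Omega>"
    and D: "polyhedral_complex D" "\<Omega> \<subseteq> \<Union>D"
    and \<sigma>: "\<sigma> \<in> C" "x \<in> \<sigma> \<inter> \<Omega>"
  obtains \<tau> where "\<tau> \<in> D" "x \<in> \<tau>" "direction_space \<sigma> \<subseteq> direction_space \<tau>"
proof -
  obtain S where S: "open S" "\<Omega> = \<Union>C \<inter> S"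
    using C(2) by (auto simp: openin_open)
  show thesis
  proof (rule direction_space_subset_cover[of \<sigma> x S D])
    show "convex \<sigma>" using C(1) \<sigma>(1) by (rule polyhedral_complex_convex)
    show "finite D" "\<And>\<tau>. \<tau> \<in> D \<Longrightarrow> closed \<tau>"
      using D(1) by (auto simp: polyhedral_complex_def polyhedron_imp_closed)
    show "\<sigma> \<inter> S \<subseteq> \<Union>D" using S D(2) \<sigma>(1) by blast
  qed (use S \<sigma> that in auto)
qed

section \<open>The operator \<open>d'\<close> on classes of representatives\<close>

lemma superform_reps_dprime:
  "(V, \<alpha>) \<in> superform_reps C \<Omega> p q \<Longrightarrow> (V, dprime \<alpha>) \<in> superform_reps C \<Omega> (Suc p) q"
  by (auto simp: superform_reps_def superform_on_dprime)

text \<open>Agreement along each convex \<open>\<sigma>\<close> passes to derivatives along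
  \<open>\<sigma>\<close>; hence \<open>d'\<close> is well defined on classes.\<close>

lemma superform_rel_dprime:
  assumes C: "polyhedral_complex C"
    and rel: "((V, \<alpha>), (W, \<beta>)) \<in> superform_rel C \<Omega> p q"
  shows "((V, dprime \<alpha>), (W, dprime \<beta>)) \<in> superform_rel C \<Omega> (Suc p) q"
proof -
  have reps: "(V, \<alpha>) \<in> superform_reps C \<Omega> p q" "(W, \<beta>) \<in> superform_reps C \<Omega> p q"
    and eq: "\<And>\<sigma> y v w. \<lbrakk>\<sigma> \<in> C; y \<in> \<sigma> \<inter> \<Omega>; length v = p; length w = q;
      set v \<subseteq> direction_space \<sigma>; set w \<subseteq> direction_space \<sigma>\<rbrakk> \<Longrightarrow> \<alpha> y v w = \<beta> y v w"
    using rel unfolding superform_rel_def by auto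
  have "dprime \<alpha> x v w = dprime \<beta> x v w"
    if "\<sigma> \<in> C" "x \<in> \<sigma> \<inter> \<Omega>" "length v = Suc p" "length w = q"
      "set v \<subseteq> direction_space \<sigma>" "set w \<subseteq> direction_space \<sigma>" for \<sigma> x v w
  proof (rule dprime_eq_on_direction_space[of \<sigma> x V p q \<alpha> W \<beta>])
    show "convex \<sigma>" using C that(1) by (rule polyhedral_complex_convex)
    show "\<alpha> y v w = \<beta> y v w" if "y \<in> \<sigma> \<inter> V \<inter> W" "length v = p" "length w = q"
      "set v \<subseteq> direction_space \<sigma>" "set w \<subseteq> direction_space \<sigma>" for y v w
      using that \<open>\<sigma> \<in> C\<close> reps by (intro eq[of \<sigma>]) (auto simp: superform_reps_def)
  qed (use that reps in \<open>auto simp: superform_reps_def\<close>)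
  then show ?thesis
    using reps[THEN superform_reps_dprime] unfolding superform_rel_def by simp
qed

text \<open>The definition collects the classes of \<open>dprime\<close> of all representatives.
  Since these coincide, a single representative computes the result.\<close>

lemma superform_dprime_class:
  assumes C: "polyhedral_complex C" and \<alpha>: "(V, \<alpha>) \<in> superform_reps C \<Omega> p q"
  shows "superform_dprime C \<Omega> p q (superform_rel C \<Omega> p q `` {(V, \<alpha>)}) =
    superform_rel C \<Omega> (Suc p) q `` {(V, dprime \<alpha>)}"
proof -
  have "superform_rel C \<Omega> (Suc p) q `` {(W, dprime \<gamma>)} = superform_rel C \<Omega> (Suc p) q `` {(V, dprime \<alpha>)}"
    if "((V, \<alpha>), (W, \<gamma>)) \<in> superform_rel C \<Omega> p q" for W \<gamma>
    using equiv_class_eq[OF equiv_superform_rel superform_rel_dprime[OF C that]] by simp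
  moreover have "((V, \<alpha>), (V, \<alpha>)) \<in> superform_rel C \<Omega> p q"
    using \<alpha> by (simp add: superform_rel_def)
  ultimately show ?thesis
    unfolding superform_dprime_def by fastforce
qed

theorem theorem2p16:
  fixes C :: "(real ^ 'r) set set" and \<Omega> :: "(real ^ 'r) set" and z :: "real ^ 'r"
    and p q :: nat and \<alpha> :: "((real ^ 'r) set \<times> (real ^ 'r) superform) set"
  assumes "polyhedral_complex C"
    and "openin (top_of_set (\<Union>C)) \<Omega>"
    and "polyhedrally_star_shaped \<Omega> z"
    and "\<alpha> \<in> superforms C \<Omega> p q"
    and "p > 0"
    and "superform_dprime C \<Omega> p q \<alpha> = superform_zero C \<Omega> (p + 1) q"
  shows "\<exists>\<beta> \<in> superforms C \<Omega> (p - 1) q. superform_dprime C \<Omega> (p - 1) q \<beta> = \<alpha>"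
proof -
  obtain n where p: "p = Suc n"
    using \<open>p > 0\<close> gr0_implies_Suc by blast
  obtain V a where \<alpha>: "\<alpha> = superform_rel C \<Omega> p q `` {(V, a)}" and reps: "(V, a) \<in> superform_reps C \<Omega> p q"
    using assms(4) unfolding superforms_def by (auto elim!: quotientE)
  then have V: "open V" "V \<inter> \<Union>C = \<Omega>" and a: "superform_on V p q a"
    by (auto simp: superform_reps_def)
  obtain D where D: "polyhedral_complex D" "openin (top_of_set (\<Union>D)) \<Omega>"
    and star_D: "\<And>\<sigma> x t. \<lbrakk>maximal_in D \<sigma>; x \<in> \<sigma> \<inter> \<Omega>; t \<in> {0..1}\<rbrakk> \<Longrightarrow> z + t *\<^sub>R (x - z) \<in> \<sigma> \<inter> \<Omega>"
    using assms(3) unfolding polyhedrally_star_shaped_def by blast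
  have \<Omega>: "\<Omega> \<subseteq> \<Union>C" "\<Omega> \<subseteq> \<Union>D"
    using openin_imp_subset[OF assms(2)] openin_imp_subset[OF D(2)] by auto

  \<comment> \<open>Membership in the zero class relates \<open>dprime a\<close> to a zero
    representative, that is, it vanishes at points of \<open>\<Omega>\<close> on the directions of
    each member of \<open>C\<close> through them.\<close>
  have "(V, dprime a) \<in> superform_rel C \<Omega> (Suc p) q `` {(V, dprime a)}"
    using equiv_class_self[OF equiv_superform_rel superform_reps_dprime[OF reps]] .
  also have "\<dots> = superform_zero C \<Omega> (Suc p) q"
    using assms(6) superform_dprime_class[OF assms(1) reps] unfolding \<alpha> by simp
  finally have closed_C: "dprime a x v w = 0"
    if "\<sigma> \<in> C" "x \<in> \<sigma> \<inter> \<Omega>" "length v = Suc p" "length w = q"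
      "set v \<subseteq> direction_space \<sigma>" "set w \<subseteq> direction_space \<sigma>" for \<sigma> x v w
    using that unfolding superform_zero_def superform_rel_def by fastforce
  have closed_D: "dprime a x v w = 0"
    if \<tau>: "\<tau> \<in> D" "x \<in> \<tau> \<inter> \<Omega>" and "length v = Suc p" "length w = q"
      "set v \<subseteq> direction_space \<tau>" "set w \<subseteq> direction_space \<tau>" for \<tau> x v w
  proof -
    obtain \<sigma> where "\<sigma> \<in> C" "x \<in> \<sigma>" "direction_space \<tau> \<subseteq> direction_space \<sigma>"
      using direction_space_subset_other_complex[OF D assms(1) \<Omega>(1) \<tau>] by blast
    then show ?thesis using that by (intro closed_C[of \<sigma>]) auto
  qed

  define U where "U = {x. \<forall>t\<in>{0..1}. z + t *\<^sub>R (x - z) \<in> V}"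
  have UV: "U \<subseteq> V"
    unfolding U_def by (auto dest!: bspec[of _ _ 1])
  have "\<Omega> \<subseteq> U"
  proof
    fix x assume x: "x \<in> \<Omega>"
    then obtain \<sigma> where "\<sigma> \<in> D" "x \<in> \<sigma>" using \<Omega> by blast
    moreover obtain \<tau> where "maximal_in D \<tau>" "\<sigma> \<subseteq> \<tau>"
      using ex_maximal_in_superset \<open>\<sigma> \<in> D\<close> D(1) unfolding polyhedral_complex_def by blast
    ultimately show "x \<in> U" using star_D x V(2) unfolding U_def by blast
  qed
  \<comment> \<open>\<open>U\<close> lies between \<open>\<Omega>\<close> and \<open>V\<close>, so
    it still cuts out \<open>\<Omega>\<close> and can carry a representative.\<close>
  with UV V have U\<Omega>: "U \<inter> \<Union>C = \<Omega>" by blast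
  interpret star_domain U z
  proof
    show "open U" unfolding U_def by (rule open_star_core[OF V(1)])
    fix x t assume x: "x \<in> U" and t: "t \<in> {0..1::real}"
    have "z + s *\<^sub>R (z + t *\<^sub>R (x - z) - z) \<in> V" if s: "s \<in> {0..1}" for s
    proof -
      \<comment> \<open>Contracting by \<open>t\<close> and then by \<open>s\<close> is contracting
        by \<open>s * t\<close>.\<close>
      have "s * t \<in> {0..1}" using s t by (auto intro: mult_le_one)
      then have "z + (s * t) *\<^sub>R (x - z) \<in> V" using x unfolding U_def by blast
      then show ?thesis by simp
    qed
    then show "z + t *\<^sub>R (x - z) \<in> U" unfolding U_def by blast
  qed
  obtain b where b: "superform_on U n q b"
    and db: "\<And>x v w. \<lbrakk>x \<in> U; length v = Suc n; length w = q\<rbrakk> \<Longrightarrow>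
      dprime b x v w = a x v w - cone_integral z (Suc n) (\<lambda>y. dprime a y ((x - z) # v) w) x"
    using superform_homotopy[OF superform_on_subset[OF a UV, unfolded p]] by blast
  have eq_max: "dprime b x v w = a x v w"
    if \<tau>: "maximal_in D \<tau>" and x: "x \<in> \<tau> \<inter> \<Omega>" and v: "length v = p" and w: "length w = q"
      and dir: "set v \<subseteq> direction_space \<tau>" "set w \<subseteq> direction_space \<tau>" for \<tau> x v w
  proof -
    have "dprime a (z + t *\<^sub>R (x - z)) ((x - z) # v) w = 0" if t: "t \<in> {0..1}" for t
    proof (rule closed_D[of \<tau>])
      show "\<tau> \<in> D" using \<tau> by (simp add: maximal_in_def)
      show "z + t *\<^sub>R (x - z) \<in> \<tau> \<inter> \<Omega>" using \<tau> x t by (rule star_D)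
      \<comment> \<open>Taking \<open>t = 0\<close> puts the centre itself into
        \<open>\<tau>\<close>, which makes \<open>x - z\<close> a direction of
        \<open>\<tau>\<close>.\<close>
      have "z \<in> \<tau>" using star_D[OF \<tau> x, of 0] by simp
      then show "set ((x - z) # v) \<subseteq> direction_space \<tau>"
        using dir x by (simp add: diff_in_direction_space)
    qed (use v w dir in auto)
    then have "cone_integral z (Suc n) (\<lambda>y. dprime a y ((x - z) # v) w) x = integral {0..1} (\<lambda>t::real. 0 :: real)"
      unfolding cone_integral_def by (intro integral_cong) simp
    then show ?thesis using db[of x v w] v w p x \<open>\<Omega> \<subseteq> U\<close> by auto
  qed
  have eq_C: "dprime b x v w = a x v w"
    if \<sigma>: "\<sigma> \<in> C" "x \<in> \<sigma> \<inter> \<Omega>" and "length v = p" "length w = q"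
      "set v \<subseteq> direction_space \<sigma>" "set w \<subseteq> direction_space \<sigma>" for \<sigma> x v w
  proof -
    obtain \<rho> where \<rho>: "\<rho> \<in> D" "x \<in> \<rho>" "direction_space \<sigma> \<subseteq> direction_space \<rho>"
      using direction_space_subset_other_complex[OF assms(1,2) D(1) \<Omega>(2) \<sigma>] by blast
    \<comment> \<open>Star-shapedness speaks of maximal members only; passing to one that contains
      \<open>\<rho>\<close> can only enlarge the direction space.\<close>
    moreover obtain \<tau> where "maximal_in D \<tau>" "\<rho> \<subseteq> \<tau>"
      using ex_maximal_in_superset \<rho>(1) D(1) unfolding polyhedral_complex_def by blast
    moreover have "direction_space \<rho> \<subseteq> direction_space \<tau>"
      using \<open>\<rho> \<subseteq> \<tau>\<close> by (rule direction_space_mono)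
    ultimately show ?thesis using that by (intro eq_max[of \<tau>]) auto
  qed

  have b_reps: "(U, b) \<in> superform_reps C \<Omega> n q"
    using open_U U\<Omega> b by (simp add: superform_reps_def)
  \<comment> \<open>The domains \<open>U\<close> and \<open>V\<close> may differ; the relation
    compares values at points of \<open>\<Omega>\<close> only.\<close>
  have "((U, dprime b), (V, a)) \<in> superform_rel C \<Omega> p q"
    using superform_reps_dprime[OF b_reps] reps eq_C unfolding superform_rel_def p by auto
  from equiv_class_eq[OF equiv_superform_rel this]
  have "superform_dprime C \<Omega> n q (superform_rel C \<Omega> n q `` {(U, b)}) = \<alpha>"
    using superform_dprime_class[OF assms(1) b_reps] \<alpha> p by simp
  moreover have "superform_rel C \<Omega> n q `` {(U, b)} \<in> superforms C \<Omega> n q"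
    unfolding superforms_def using b_reps by (rule quotientI)
  ultimately show ?thesis unfolding p diff_Suc_1 by blast
qed

end
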